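(* For every integer $T\ge 3$, the toric ideal $I_{A^T}$ is generated by homogeneous binomials of degree at most $6$; equivalently, there is a Markov basis for the toric homogeneous Markov chain model on three states without self-loops and without initial parameters, with time $T$, consisting of moves (binomials) of degree at most $6$.
   Context: For an integer $T\ge 2$, let $\Omega_T$ be the set of words $w=s_1\cdots s_T$ over $\{1,2,3\}$ with $s_l\neq s_{l+1}$ for all $l$. For $w\in\Omega_T$ and $i\ne j$, let $x_{ij}(w)$ be the number of $l\in\{1,\dots,T-1\}$ with $s_ls_{l+1}=ij$. The design matrix $A^T$ is the $6\times 3\cdot2^{T-1}$ matrix with column $[x_{12}(w),x_{13}(w),x_{21}(w),x_{23}(w),x_{31}(w),x_{32}(w)]$ for $w\in\Omega_T$. The toric ideal $I_{A^T}$ is the kernel of the ring homomorphism $\psi:\mathbb C[P(w): w\in\Omega_T]\to\mathbb C[p_{ij}: i,j\in\{1,2,3\}, i\ne j]$, $\psi(P(w))=p_{s_1s_2}p_{s_2s_3}\cdots p_{s_{T-1}s_T}$. A Markov basis is a finite set $\mathcal Z\subset\ker_{\mathbb Z}A^T$ such that any two nonnegative integer vectors $x,y$ with $A^Tx=A^Ty$ are connected by a sequence of moves from $\mathcal Z$ keeping all intermediate vectors nonnegative; Markov bases correspond to binomial generating sets of $I_{A^T}$. *)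

theory Defs
  imports Main
begin

definition Omega :: "nat \<Rightarrow> nat list set" where
  "Omega T = {w. length w = T \<and> set w \<subseteq> {1,2,3} \<and>
                 (\<forall>l. Suc l < T \<longrightarrow> w ! l \<noteq> w ! Suc l)}"

definition trans_count :: "nat list \<Rightarrow> nat \<Rightarrow> nat \<Rightarrow> nat" where
  "trans_count w i j = card {l. Suc l < length w \<and> w ! l = i \<and> w ! Suc l = j}"

text \<open>Entry (i,j) of A^T x, for a vector x indexed by Omega T.\<close>
definition suff_stat :: "nat \<Rightarrow> (nat list \<Rightarrow> int) \<Rightarrow> nat \<Rightarrow> nat \<Rightarrow> int" where
  "suff_stat T x i j = (\<Sum>w\<in>Omega T. x w * int (trans_count w i j))"

definition edge_pairs :: "(nat \<times> nat) set" where
  "edge_pairs = {(i,j). i \<in> {1,2,3} \<and> j \<in> {1,2,3} \<and> i \<noteq> j}"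

definition supported :: "nat \<Rightarrow> (nat list \<Rightarrow> 'a::zero) \<Rightarrow> bool" where
  "supported T x = (\<forall>w. w \<notin> Omega T \<longrightarrow> x w = 0)"

definition is_move :: "nat \<Rightarrow> (nat list \<Rightarrow> int) \<Rightarrow> bool" where
  "is_move T z = (supported T z \<and> (\<forall>(i,j)\<in>edge_pairs. suff_stat T z i j = 0))"

text \<open>One step: add or subtract a move, staying nonnegative (vectors have type nat).\<close>
definition markov_step :: "nat \<Rightarrow> (nat list \<Rightarrow> int) set \<Rightarrow> (nat list \<Rightarrow> nat) \<Rightarrow> (nat list \<Rightarrow> nat) \<Rightarrow> bool" where
  "markov_step T Z x y = (\<exists>z\<in>Z. (\<forall>w. int (y w) = int (x w) + z w) \<or> (\<forall>w. int (y w) = int (x w) - z w))"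

definition markov_basis :: "nat \<Rightarrow> (nat list \<Rightarrow> int) set \<Rightarrow> bool" where
  "markov_basis T Z = (finite Z \<and> (\<forall>z\<in>Z. is_move T z) \<and>
     (\<forall>x y :: nat list \<Rightarrow> nat. supported T x \<longrightarrow> supported T y \<longrightarrow>
        (\<forall>(i,j)\<in>edge_pairs. suff_stat T (\<lambda>w. int (x w)) i j = suff_stat T (\<lambda>w. int (y w)) i j) \<longrightarrow>
        (markov_step T Z)\<^sup>*\<^sup>* x y))"

text \<open>Degree of the binomial P^{z+} - P^{z-}: the sum of the positive parts of z.\<close>
definition move_degree :: "nat \<Rightarrow> (nat list \<Rightarrow> int) \<Rightarrow> nat" where
  "move_degree T z = (\<Sum>w\<in>Omega T. nat (z w))"

end

theory Submission
  imports Defs "HOL-Library.Multiset"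
begin

text \<open>
  For a word with \<open>T - 1\<close> transitions let \<open>d\<close> and \<open>s\<close> be the differences and the sums of the numbers of
  forward and backward transitions along the three edges 12, 23, 31 of the triangle. The word leaves
  each state as often as it enters it, up to its two ends, so any two coordinates of \<open>d\<close> differ by
  at most 1. As any two transitions along different edges share a state, an Euler trail exists for
  all \<open>d\<close> of this kind and all \<open>s\<close> with \<open>\<bar>d\<bar> \<le> s\<close>, \<open>s \<equiv> d\<close> (mod 2) and total \<open>T - 1\<close>.
  For words with given vectors \<open>d\<close>, the vectors \<open>s - \<bar>d\<bar>\<close> form a two-way contingency table, and such
  tables are connected by quadratic moves. So only the multiset of the vectors \<open>d\<close> matters.

  Quadratic moves that bring the totals \<open>t\<close> of two vectors \<open>d\<close> closer together decrease the sum of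
  the \<open>t\<^sup>2\<close> and do not increase the sum of any \<open>\<bar>d\<^sub>i\<bar>\<close>. When no such move is left, the vectors \<open>d\<close> lie on
  one cell of the regular subdivision induced by \<open>t\<^sup>2\<close>: there is an affine minorant of \<open>t\<^sup>2\<close> that is
  sharp exactly on the cell. Any other multiset with the same sum and no larger sum of \<open>t\<^sup>2\<close> lies on
  the same cell. Each cell is either a simplex, which leaves no freedom, or an octahedron
  \<open>\<mu> \<plusminus> e\<^sub>i\<close>, on which the quadratic moves that replace one diagonal by another one suffice.
  Hence degree 2 is enough.
\<close>

section \<open>Transition counts of words\<close>

text \<open>The indices name the undirected edges of the triangle; \<open>src\<close> and
  \<open>tgt\<close> below orient them along the cycle 1 -> 2 -> 3 -> 1.\<close>

datatype idx = I1 | I2 | I3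

lemma all_idx: "(\<forall>i. P i) \<longleftrightarrow> P I1 \<and> P I2 \<and> P I3"
  by (metis idx.exhaust)

definition tot :: "(idx \<Rightarrow> 'a::comm_monoid_add) \<Rightarrow> 'a" where
  "tot f = f I1 + f I2 + f I3"

text \<open>Up to parity and the bound \<open>T - 1\<close> on the absolute total, this
  characterises the vectors \<open>dv w\<close>: see \<open>Omega_spread\<close> for one direction
  and \<open>word_exists\<close> for the other.\<close>

definition spread :: "(idx \<Rightarrow> int) \<Rightarrow> bool" where
  "spread d \<longleftrightarrow> (\<forall>i j. d i \<le> d j + 1)"

lemma spread_iff: "spread d \<longleftrightarrow> \<bar>d I1 - d I2\<bar> \<le> 1 \<and> \<bar>d I2 - d I3\<bar> \<le> 1 \<and> \<bar>d I3 - d I1\<bar> \<le> 1"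
  unfolding spread_def all_idx by auto

fun src :: "idx \<Rightarrow> nat" where
  "src I1 = 1" | "src I2 = 2" | "src I3 = 3"

fun tgt :: "idx \<Rightarrow> nat" where
  "tgt I1 = 2" | "tgt I2 = 3" | "tgt I3 = 1"

definition up :: "nat list \<Rightarrow> idx \<Rightarrow> nat" where
  "up w i = trans_count w (src i) (tgt i)"

definition down :: "nat list \<Rightarrow> idx \<Rightarrow> nat" where
  "down w i = trans_count w (tgt i) (src i)"

definition dv :: "nat list \<Rightarrow> idx \<Rightarrow> int" where
  "dv w i = int (up w i) - int (down w i)"

definition sv :: "nat list \<Rightarrow> idx \<Rightarrow> int" where
  "sv w i = int (up w i) + int (down w i)"

lemma Omega_iff: "w \<in> Omega T \<longleftrightarrow> length w = T \<and> set w \<subseteq> {1,2,3} \<and> distinct_adj w"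
  by (auto simp: Omega_def distinct_adj_conv_nth)

lemma finite_Omega: "finite (Omega T)"
  by (rule finite_subset[OF _ finite_lists_length_eq[of "{1,2,3}" T]]) (auto simp: Omega_def)

lemma trans_count_simps [simp]:
  "trans_count [] i j = 0"
  "trans_count [a] i j = 0"
  "trans_count (a # b # w) i j = of_bool (a = i \<and> b = j) + trans_count (b # w) i j"
proof -
  show "trans_count [] i j = 0" "trans_count [a] i j = 0"
    by (auto simp: trans_count_def)
  let ?S = "{l. Suc l < length (b # w) \<and> (b # w) ! l = i \<and> (b # w) ! Suc l = j}"
  have fin: "finite ?S"
    by (rule finite_subset[of _ "{..<length (b # w)}"]) auto
  have "{l. Suc l < length (a # b # w) \<and> (a # b # w) ! l = i \<and> (a # b # w) ! Suc l = j}
      = (if a = i \<and> b = j then {0} else {}) \<union> Suc ` ?S" (is "?L = ?R")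
  proof (rule set_eqI)
    show "l \<in> ?L \<longleftrightarrow> l \<in> ?R" for l
      by (cases l) (auto simp: image_iff)
  qed
  moreover have "card (Suc ` ?S) = card ?S"
    by (simp add: card_image)
  ultimately show "trans_count (a # b # w) i j = of_bool (a = i \<and> b = j) + trans_count (b # w) i j"
    unfolding trans_count_def using fin by (auto simp: card_insert_if)
qed

text \<open>The letter \<open>a\<close> at the cut belongs to both parts, so no transition is lost
  and none is counted twice.\<close>

lemma trans_count_append:
  "trans_count (p @ a # q) i j = trans_count (p @ [a]) i j + trans_count (a # q) i j"
proof (induction p)
  case (Cons c p)
  then show ?case by (cases p) auto
qed simp

lemma distinct_adj_append_Cons:
  "distinct_adj (p @ a # q) \<longleftrightarrow> distinct_adj (p @ [a]) \<and> distinct_adj (a # q)"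
  by (induction p rule: induct_list012) auto

lemma dv_Cons: "dv (a # b # w) i = of_bool (a = src i \<and> b = tgt i) - of_bool (a = tgt i \<and> b = src i) + dv (b # w) i"
  by (simp add: dv_def up_def down_def)

text \<open>The left-hand sides are the net outflows of the states 1, 2 and 3. Every inner visit to
  a state contributes one arrival and one departure, so only the two ends of the word count.\<close>

lemma word_balance:
  assumes "distinct_adj w" "set w \<subseteq> {1,2,3}" "w \<noteq> []"
  shows "dv w I1 - dv w I3 = of_bool (hd w = 1) - of_bool (last w = 1) \<and>
         dv w I2 - dv w I1 = of_bool (hd w = 2) - of_bool (last w = 2) \<and>
         dv w I3 - dv w I2 = of_bool (hd w = 3) - of_bool (last w = 3)"
  using assms
proof (induction w rule: induct_list012)
  case (3 a b w)
  then have "(a, b) \<in> {(1,2), (1,3), (2,1), (2,3), (3,1), (3,2)}"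
    by auto
  moreover have "distinct_adj (b # w)" "set (b # w) \<subseteq> {1,2,3}" "b # w \<noteq> []"
    using 3 by auto
  note 3(2)[OF this]
  moreover have "last (a # b # w) = last (b # w)"
    by simp
  ultimately show ?case
    by (elim insertE emptyE) (simp_all add: dv_Cons del: last.simps)
qed (auto simp: dv_def up_def down_def)

lemma word_tot:
  assumes "distinct_adj w" "set w \<subseteq> {1,2,3}"
  shows "tot (sv w) = int (length w - 1)"
  using assms
proof (induction w rule: induct_list012)
  case (3 a b w)
  then have "(a, b) \<in> {(1,2), (1,3), (2,1), (2,3), (3,1), (3,2)}"
    by auto
  moreover have "distinct_adj (b # w)" "set (b # w) \<subseteq> {1,2,3}"
    using 3 by auto
  note 3(2)[OF this]
  ultimately show ?case
    by (elim insertE emptyE) (simp_all add: sv_def up_def down_def tot_def)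
qed (auto simp: sv_def up_def down_def tot_def)

lemma Omega_spread: "w \<in> Omega T \<Longrightarrow> T > 0 \<Longrightarrow> spread (dv w)"
  using word_balance[of w] unfolding Omega_iff spread_iff
  by (cases "w = []") (auto simp: abs_le_iff of_bool_def split: if_splits)

lemma Omega_tot: "w \<in> Omega T \<Longrightarrow> tot (sv w) = int (T - 1)"
  using word_tot[of w] unfolding Omega_iff by auto

lemma dv_le_sv: "\<bar>dv w i\<bar> \<le> sv w i"
  by (auto simp: dv_def sv_def)

lemma even_dv_sv: "even (sv w i - dv w i)"
  by (auto simp: dv_def sv_def)

section \<open>Words with prescribed transition counts\<close>

lemma add_forward_cycle:
  assumes "set w \<subseteq> {1,2,3}" "distinct_adj w" "w \<noteq> []"
  obtains w' where "length w' = length w + 3" "set w' \<subseteq> {1,2,3}" "distinct_adj w'"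
    "up w' = (\<lambda>i. Suc (up w i))" "down w' = down w"
proof -
  obtain a q where w: "w = a # q"
    using assms(3) by (cases w) auto
  consider "a = 1" | "a = 2" | "a = 3"
    using assms(1) w by auto
  then show thesis
  proof cases
    case 1
    show thesis
      using assms 
      by (intro that[of "1 # 2 # 3 # w"]) (simp_all add: w 1 fun_eq_iff all_idx up_def down_def)
  next
    case 2
    show thesis
      using assms 
      by (intro that[of "2 # 3 # 1 # w"]) (simp_all add: w 2 fun_eq_iff all_idx up_def down_def)
  next
    case 3
    show thesis
      using assms 
      by (intro that[of "3 # 1 # 2 # w"]) (simp_all add: w 3 fun_eq_iff all_idx up_def down_def)
  qed
qed

lemma add_backward_cycle:
  assumes "set w \<subseteq> {1,2,3}" "distinct_adj w" "w \<noteq> []"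
  obtains w' where "length w' = length w + 3" "set w' \<subseteq> {1,2,3}" "distinct_adj w'"
    "down w' = (\<lambda>i. Suc (down w i))" "up w' = up w"
proof -
  obtain a q where w: "w = a # q"
    using assms(3) by (cases w) auto
  consider "a = 1" | "a = 2" | "a = 3"
    using assms(1) w by auto
  then show thesis
  proof cases
    case 1
    show thesis
      using assms 
      by (intro that[of "1 # 3 # 2 # w"]) (simp_all add: w 1 fun_eq_iff all_idx up_def down_def)
  next
    case 2
    show thesis
      using assms 
      by (intro that[of "2 # 1 # 3 # w"]) (simp_all add: w 2 fun_eq_iff all_idx up_def down_def)
  next
    case 3
    show thesis
      using assms 
      by (intro that[of "3 # 2 # 1 # w"]) (simp_all add: w 3 fun_eq_iff all_idx up_def down_def)
  qed
qed

text \<open>The irreducible case: no edge is used both ways and no full cycle is left. Entries of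
  opposite sign would differ by at least 2, so all transitions run in one direction. A zero entry
  then bounds the others by 1, which leaves only trails with one or two transitions.\<close>

lemma word_exists_short:
  fixes u v :: "idx \<Rightarrow> nat"
  assumes "spread (\<lambda>i. int (u i) - int (v i))" "tot u + tot v = Suc n"
    and "\<forall>i. u i = 0 \<or> v i = 0" "\<not> (\<forall>i. u i > 0)" "\<not> (\<forall>i. v i > 0)"
  shows "\<exists>w. length w = n + 2 \<and> set w \<subseteq> {1,2,3} \<and> distinct_adj w \<and> up w = u \<and> down w = v"
proof -
  have spread_le: "int (u i) - int (v i) \<le> int (u j) - int (v j) + 1" for i j
    using assms(1) unfolding spread_def by blast
  have "(\<forall>k. v k = 0) \<or> (\<forall>k. u k = 0)"
  proof (rule ccontr)
    assume "\<not> ?thesis"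
    then obtain i j where "v i > 0" "u j > 0" by auto
    then have "u i = 0" "v j = 0" using assms(3)[rule_format, of i] assms(3)[rule_format, of j] by simp_all
    then show False
      using spread_le[of j i] \<open>v i > 0\<close> \<open>u j > 0\<close> by simp
  qed
  then show ?thesis
  proof
    assume "\<forall>k. v k = 0"
    then have zero: "v k = 0" for k by blast
    have one: "u k = 0 \<or> u k = 1" for k
    proof -
      obtain j where "u j = 0"
        using assms(4,5) by auto
      then have "int (u k) \<le> 1"
        using spread_le[of k j] spread_le[of j k] zero[of k] zero[of j] by simp
      then show ?thesis by linarith
    qed
    have "(u I1, u I2, u I3) \<in> {(1,0,0), (0,1,0), (0,0,1), (1,1,0), (0,1,1), (1,0,1)}"
      using one[of I1] one[of I2] one[of I3] assms(4,5) assms(2) zero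
      unfolding all_idx tot_def by (elim disjE) simp_all
    then consider "u I1 = 1" "u I2 = 0" "u I3 = 0" | "u I1 = 0" "u I2 = 1" "u I3 = 0" | "u I1 = 0" "u I2 = 0" "u I3 = 1" | "u I1 = 1" "u I2 = 1" "u I3 = 0" | "u I1 = 0" "u I2 = 1" "u I3 = 1" | "u I1 = 1" "u I2 = 0" "u I3 = 1"
      by auto
    then show ?thesis
    proof cases
      case 1
      then show ?thesis
        using assms(2) zero
        by (intro exI[of _ "[1, 2]"]) (simp add: fun_eq_iff all_idx up_def down_def tot_def)
      next
      case 2
      then show ?thesis
        using assms(2) zero
        by (intro exI[of _ "[2, 3]"]) (simp add: fun_eq_iff all_idx up_def down_def tot_def)
      next
      case 3
      then show ?thesis
        using assms(2) zero
        by (intro exI[of _ "[3, 1]"]) (simp add: fun_eq_iff all_idx up_def down_def tot_def)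
      next
      case 4
      then show ?thesis
        using assms(2) zero
        by (intro exI[of _ "[1, 2, 3]"]) (simp add: fun_eq_iff all_idx up_def down_def tot_def)
      next
      case 5
      then show ?thesis
        using assms(2) zero
        by (intro exI[of _ "[2, 3, 1]"]) (simp add: fun_eq_iff all_idx up_def down_def tot_def)
      next
      case 6
      then show ?thesis
        using assms(2) zero
        by (intro exI[of _ "[3, 1, 2]"]) (simp add: fun_eq_iff all_idx up_def down_def tot_def)
    qed
  next
    assume "\<forall>k. u k = 0"
    then have zero: "u k = 0" for k by blast
    have one: "v k = 0 \<or> v k = 1" for k
    proof -
      obtain j where "v j = 0"
        using assms(4,5) by auto
      then have "int (v k) \<le> 1"
        using spread_le[of k j] spread_le[of j k] zero[of k] zero[of j] by simp
      then show ?thesis by linarith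
    qed
    have "(v I1, v I2, v I3) \<in> {(1,0,0), (0,1,0), (0,0,1), (1,1,0), (0,1,1), (1,0,1)}"
      using one[of I1] one[of I2] one[of I3] assms(4,5) assms(2) zero
      unfolding all_idx tot_def by (elim disjE) simp_all
    then consider "v I1 = 1" "v I2 = 0" "v I3 = 0" | "v I1 = 0" "v I2 = 1" "v I3 = 0" | "v I1 = 0" "v I2 = 0" "v I3 = 1" | "v I1 = 1" "v I2 = 1" "v I3 = 0" | "v I1 = 0" "v I2 = 1" "v I3 = 1" | "v I1 = 1" "v I2 = 0" "v I3 = 1"
      by auto
    then show ?thesis
    proof cases
      case 1
      then show ?thesis
        using assms(2) zero
        by (intro exI[of _ "[2, 1]"]) (simp add: fun_eq_iff all_idx up_def down_def tot_def)
      next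
      case 2
      then show ?thesis
        using assms(2) zero
        by (intro exI[of _ "[3, 2]"]) (simp add: fun_eq_iff all_idx up_def down_def tot_def)
      next
      case 3
      then show ?thesis
        using assms(2) zero
        by (intro exI[of _ "[1, 3]"]) (simp add: fun_eq_iff all_idx up_def down_def tot_def)
      next
      case 4
      then show ?thesis
        using assms(2) zero
        by (intro exI[of _ "[3, 2, 1]"]) (simp add: fun_eq_iff all_idx up_def down_def tot_def)
      next
      case 5
      then show ?thesis
        using assms(2) zero
        by (intro exI[of _ "[1, 3, 2]"]) (simp add: fun_eq_iff all_idx up_def down_def tot_def)
      next
      case 6
      then show ?thesis
        using assms(2) zero
        by (intro exI[of _ "[2, 1, 3]"]) (simp add: fun_eq_iff all_idx up_def down_def tot_def)
    qed
  qed
qed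

text \<open>An Euler trail is built by peeling. Removing a back-and-forth pair or a full cycle keeps
  the differences within spread 1, and the removed piece is reinserted into the word given by
  induction. The total is \<open>Suc n\<close> so that this word has a transition, hence two
  distinct letters.\<close>

lemma word_exists_aux:
  fixes u v :: "idx \<Rightarrow> nat"
  assumes "spread (\<lambda>i. int (u i) - int (v i))" "tot u + tot v = Suc n"
  shows "\<exists>w. length w = n + 2 \<and> set w \<subseteq> {1,2,3} \<and> distinct_adj w \<and> up w = u \<and> down w = v"
  using assms
proof (induction n arbitrary: u v rule: less_induct)
  case (less n)
  consider (loop) i where "u i > 0" "v i > 0" | (fwd) "\<forall>i. u i > 0" "\<forall>i. v i = 0"
    | (bwd) "\<forall>i. v i > 0" "\<forall>i. u i = 0"
    | (short) "\<forall>i. u i = 0 \<or> v i = 0" "\<not> (\<forall>i. u i > 0)" "\<not> (\<forall>i. v i > 0)"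
    by (metis gr0I)
  then show ?case
  proof cases
    case loop
    show ?thesis
    \<comment> \<open>With only two transitions, removing the pair would leave none and the
      induction hypothesis would not apply.\<close>
    proof (cases "n = 1")
      case True
      have "\<forall>k. u k = of_bool (k = i) \<and> v k = of_bool (k = i)"
        using loop less.prems(2) True by (cases i) (auto simp: tot_def all_idx)
      then show ?thesis
        using True by (intro exI[of _ "[src i, tgt i, src i]"], cases i)
          (auto simp: fun_eq_iff all_idx up_def down_def)
    next
      case False
      have n: "n \<ge> 2"
        using loop less.prems(2) False by (cases i) (auto simp: tot_def)
      have eqn: "n - 2 + 2 = n" "n - 2 < n"
        using n by auto
      let ?u = "u(i := u i - 1)" and ?v = "v(i := v i - 1)"
      have "(\<lambda>k. int (?u k) - int (?v k)) = (\<lambda>k. int (u k) - int (v k))"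
        using loop by auto
      then have sp: "spread (\<lambda>k. int (?u k) - int (?v k))"
        using less.prems(1) by (simp only:)
      have tt: "tot ?u + tot ?v = Suc (n - 2)"
        using loop less.prems(2) n by (cases i) (auto simp: tot_def)
      obtain w where w: "length w = n" "set w \<subseteq> {1,2,3}" "distinct_adj w" "up w = ?u" "down w = ?v"
        using less.IH[OF _ sp tt] n eqn by (auto simp only:)
      obtain x y w' where xy: "w = x # y # w'"
        using w(1) n by (metis Suc_le_length_iff numeral_2_eq_2)
      have "x \<noteq> y" "{x, y} \<subseteq> {1,2,3}"
        using w(2,3) xy by auto
      \<comment> \<open>Two distinct letters and the two ends of an edge must overlap, since there
        are only three states.\<close>
      then have "src i \<in> set w \<or> tgt i \<in> set w"
        using xy by (cases i) auto
      then obtain a b where ab: "a \<in> set w" "(a, b) = (src i, tgt i) \<or> (a, b) = (tgt i, src i)"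
        by blast
      obtain p q where pq: "w = p @ a # q"
        using split_list[OF ab(1)] by blast
      let ?w = "p @ a # b # a # q"
      have neq: "a \<noteq> b" "b \<in> {1,2,3}"
        using ab(2) by (cases i; auto)+
      have tc: "trans_count ?w k l = trans_count w k l + of_bool (a = k \<and> b = l) + of_bool (b = k \<and> a = l)" for k l
        unfolding pq trans_count_append[of p a "b # a # q"] trans_count_append[of p a q] by simp
      have eq: "up ?w k = up w k + of_bool (k = i) \<and> down ?w k = down w k + of_bool (k = i)" for k
        using ab(2) unfolding up_def down_def tc by (cases i; cases k) auto
      have "up ?w = u \<and> down ?w = v"
        using eq w(4,5) loop by (auto simp: fun_eq_iff)
      moreover have "distinct_adj ?w"
        using w(3) neq unfolding pq distinct_adj_append_Cons[of p a "b # a # q"] distinct_adj_append_Cons[of p a q]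
        by auto
      ultimately show ?thesis
        using w(1,2) neq pq by (intro exI[of _ ?w]) auto
    qed
  next
    case fwd
    show ?thesis
    \<comment> \<open>Here the transitions form exactly one cycle, so nothing is left after removing
      it.\<close>
    proof (cases "n = 2")
      case True
      have "\<forall>k. u k = 1"
        using fwd less.prems(2) True unfolding tot_def all_idx by linarith
      then show ?thesis
        using True fwd by (intro exI[of _ "[1, 2, 3, 1]"])
          (simp add: fun_eq_iff all_idx up_def down_def)
    next
      case False
      have n: "n \<ge> 3"
        using fwd less.prems(2) False unfolding tot_def all_idx by linarith
      have eqn: "n - 3 + 2 = n - 1" "n - 3 < n"
        using n by auto
      define x where "x k = u k - 1" for k
      have x: "u k = Suc (x k)" for k
        using fwd(1) by (simp add: x_def)
      have sp: "spread (\<lambda>k. int (x k) - int (v k))"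
        using less.prems(1) unfolding spread_def x by (simp add: algebra_simps)
      have tt: "tot x + tot v = Suc (n - 3)"
        using less.prems(2) n unfolding tot_def x by simp
      obtain w where w: "length w = n - 1" "set w \<subseteq> {1,2,3}" "distinct_adj w" "up w = x" "down w = v"
        using less.IH[OF _ sp tt] n eqn by (auto simp only:)
      have "w \<noteq> []"
        using w(1) n by auto
      then obtain w' where w': "length w' = length w + 3" "set w' \<subseteq> {1,2,3}" "distinct_adj w'"
        "up w' = (\<lambda>i. Suc (up w i))" "down w' = down w"
        using add_forward_cycle[OF w(2,3)] by blast
      have "up w' = u" "down w' = v"
        unfolding w'(4,5) w(4,5) by (rule ext, simp add: x)+
      moreover have "length w' = n + 2"
        using w'(1) w(1) n by simp
      ultimately show ?thesis
        using w'(2,3) by blast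
    qed
  next
    case bwd
    show ?thesis
    proof (cases "n = 2")
      case True
      have "\<forall>k. v k = 1"
        using bwd less.prems(2) True unfolding tot_def all_idx by linarith
      then show ?thesis
        using True bwd by (intro exI[of _ "[1, 3, 2, 1]"])
          (simp add: fun_eq_iff all_idx up_def down_def)
    next
      case False
      have n: "n \<ge> 3"
        using bwd less.prems(2) False unfolding tot_def all_idx by linarith
      have eqn: "n - 3 + 2 = n - 1" "n - 3 < n"
        using n by auto
      define x where "x k = v k - 1" for k
      have x: "v k = Suc (x k)" for k
        using bwd(1) by (simp add: x_def)
      have sp: "spread (\<lambda>k. int (u k) - int (x k))"
        using less.prems(1) unfolding spread_def x by (simp add: algebra_simps)
      have tt: "tot u + tot x = Suc (n - 3)"
        using less.prems(2) n unfolding tot_def x by simp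
      obtain w where w: "length w = n - 1" "set w \<subseteq> {1,2,3}" "distinct_adj w" "up w = u" "down w = x"
        using less.IH[OF _ sp tt] n eqn by (auto simp only:)
      have "w \<noteq> []"
        using w(1) n by auto
      then obtain w' where w': "length w' = length w + 3" "set w' \<subseteq> {1,2,3}" "distinct_adj w'"
        "down w' = (\<lambda>i. Suc (down w i))" "up w' = up w"
        using add_backward_cycle[OF w(2,3)] by blast
      have "up w' = u" "down w' = v"
        unfolding w'(4,5) w(4,5) by (rule ext, simp add: x)+
      moreover have "length w' = n + 2"
        using w'(1) w(1) n by simp
      ultimately show ?thesis
        using w'(2,3) by blast
    qed
  next
    case short
    then show ?thesis
      using word_exists_short[OF less.prems] by blast
  qed
qed

text \<open>The forward and backward counts are half the sum and half the difference of
  \<open>s\<close> and \<open>d\<close>; the bound and the parity make them natural numbers.\<close>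

lemma word_exists:
  assumes "spread d" "\<And>i. \<bar>d i\<bar> \<le> s i" "\<And>i. even (s i - d i)" "tot s = int (T - 1)" "T \<ge> 2"
  obtains w where "w \<in> Omega T" "dv w = d" "sv w = s"
proof -
  let ?u = "\<lambda>i. nat ((s i + d i) div 2)" and ?v = "\<lambda>i. nat ((s i - d i) div 2)"
  have u: "int (?u i) = (s i + d i) div 2" and v: "int (?v i) = (s i - d i) div 2" for i
    using assms(2)[of i] by auto
  have ev: "even (s i + d i)" for i
    using assms(3)[of i] by presburger
  have d: "int (?u i) - int (?v i) = d i" and s: "int (?u i) + int (?v i) = s i" for i
    unfolding u v using ev[of i] assms(3)[of i] by presburger+
  have "int (tot ?u + tot ?v) = tot s"
    unfolding tot_def using s[of I1] s[of I2] s[of I3] by linarith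
  then have "tot ?u + tot ?v = Suc (T - 2)"
    using assms(4,5) by linarith
  then obtain w where w: "length w = T - 2 + 2" "set w \<subseteq> {1,2,3}" "distinct_adj w" "up w = ?u" "down w = ?v"
    using word_exists_aux[of ?u ?v "T - 2"] assms(1) unfolding d by blast
  show thesis
  proof
    show "w \<in> Omega T"
      using w(1-3) assms(5) unfolding Omega_iff by auto
    show "dv w = d" "sv w = s"
      using w(4,5) d s by (auto simp: dv_def sv_def)
  qed
qed

section \<open>Vectors of spread at most one\<close>

text \<open>The pairs of totals differing by at least 4 that no quadratic move can bring closer together.\<close>
definition stuck :: "(idx \<Rightarrow> int) \<Rightarrow> (idx \<Rightarrow> int) \<Rightarrow> bool" where
  "stuck d e \<longleftrightarrow> tot d mod 3 \<noteq> 0 \<and> (\<forall>i. e i = d i + 2) \<or>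
     tot d mod 3 = 1 \<and> tot e = tot d + 4 \<and> (\<forall>i. d i + 1 \<le> e i)"

text \<open>Here \<open>m\<close> is the mean of the entries rounded down. The total therefore fixes
  the vector up to the positions of the larger entries.\<close>

lemma spread_floor:
  assumes "spread d" "3 * m \<le> tot d" "tot d \<le> 3 * m + 2"
  shows "d i = m \<or> d i = m + 1"
proof -
  have "\<forall>i. m \<le> d i \<and> d i \<le> m + 1"
    using assms unfolding spread_def all_idx tot_def by (intro conjI; linarith)
  then have "m \<le> d i" "d i \<le> m + 1" by blast+
  then show ?thesis by linarith
qed

lemma spread_cases:
  assumes "spread d"
  shows spread_cases0: "tot d = 3 * m \<Longrightarrow> (d I1, d I2, d I3) = (m, m, m)"
    and spread_cases1: "tot d = 3 * m + 1 \<Longrightarrow> (d I1, d I2, d I3) = (m + 1, m, m) \<or>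
          (d I1, d I2, d I3) = (m, m + 1, m) \<or> (d I1, d I2, d I3) = (m, m, m + 1)"
    and spread_cases2: "tot d = 3 * m + 2 \<Longrightarrow> (d I1, d I2, d I3) = (m, m + 1, m + 1) \<or>
          (d I1, d I2, d I3) = (m + 1, m, m + 1) \<or> (d I1, d I2, d I3) = (m + 1, m + 1, m)"
  using spread_floor[OF assms, of m I1] spread_floor[OF assms, of m I2] spread_floor[OF assms, of m I3]
  by (auto simp: tot_def)

text \<open>The vector \<open>v\<close> is transferred from \<open>e\<close> to \<open>d\<close>. As
  \<open>v\<close> lies between 0 and \<open>e - d\<close>, each new entry lies between the old
  ones, so by convexity the sums of absolute values do not grow. The bounds on \<open>tot v\<close>
  bring the totals strictly closer together.\<close>

lemma rebalance:
  assumes "spread d" "spread e" "even (tot e - tot d)" "tot d + 4 \<le> tot e" "\<not> stuck d e"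
  obtains v where "spread (\<lambda>i. d i + v i)" "spread (\<lambda>i. e i - v i)"
    "\<And>i. 0 \<le> v i" "\<And>i. v i \<le> e i - d i" "0 < tot v" "tot v < tot e - tot d" "even (tot v)"
proof -
  define P where "P v \<longleftrightarrow> spread (\<lambda>i. d i + v i) \<and> spread (\<lambda>i. e i - v i) \<and>
    (\<forall>i. 0 \<le> v i \<and> v i \<le> e i - d i) \<and> 0 < tot v \<and> tot v < tot e - tot d \<and> even (tot v)" for v
  have "\<exists>v. P v"
  proof (cases "tot d + 8 \<le> tot e")
    case True
    \<comment> \<open>Totals at least 8 apart and spread at most 1 force every entry of
      \<open>e - d\<close> to be at least 2.\<close>
    have "P (\<lambda>_. 2)"
      using assms(1,2) True unfolding P_def tot_def spread_iff all_idx by (auto simp: abs_le_iff)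
    then show ?thesis by (rule exI[of P])
  next
    case False
    define m where "m = tot d div 3"
    have m: "tot d = 3 * m \<or> tot d = 3 * m + 1 \<or> tot d = 3 * m + 2"
      unfolding m_def by presburger
    have te: "tot e = tot d + 4 \<or> tot e = tot d + 6"
      using False assms(3,4) by presburger
    \<comment> \<open>For totals 4 or 6 apart a transfer of total 2 is tried: one unit in each of
      two coordinates, with three choices for the coordinate left out.\<close>
    let ?v1 = "\<lambda>i. of_bool (i \<noteq> I1)" and ?v2 = "\<lambda>i. of_bool (i \<noteq> I2)" and ?v3 = "\<lambda>i. of_bool (i \<noteq> I3)"
    have "P ?v1 \<or> P ?v2 \<or> P ?v3"
      using m te
    proof (elim disjE)
      assume t: "tot d = 3 * m" "tot e = tot d + 4"
      then have e: "tot e = 3 * (m + 1) + 1" and "tot d mod 3 = 0"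
        by (simp, presburger)
      with assms(5) spread_cases0[OF assms(1) t(1)] spread_cases1[OF assms(2) e]
      show ?thesis
        unfolding P_def spread_def all_idx stuck_def prod.inject
        by (elim disjE conjE; simp add: tot_def)
    next
      assume t: "tot d = 3 * m" "tot e = tot d + 6"
      then have e: "tot e = 3 * (m + 2)" and "tot d mod 3 = 0"
        by (simp, presburger)
      with assms(5) spread_cases0[OF assms(1) t(1)] spread_cases0[OF assms(2) e]
      show ?thesis
        unfolding P_def spread_def all_idx stuck_def prod.inject
        by (elim disjE conjE; simp add: tot_def)
    next
      assume t: "tot d = 3 * m + 1" "tot e = tot d + 4"
      then have e: "tot e = 3 * (m + 1) + 2" and "tot d mod 3 = 1"
        by (simp, presburger)
      with assms(5) spread_cases1[OF assms(1) t(1)] spread_cases2[OF assms(2) e]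
      show ?thesis
        unfolding P_def spread_def all_idx stuck_def prod.inject
        by (elim disjE conjE; simp add: tot_def)
    next
      assume t: "tot d = 3 * m + 1" "tot e = tot d + 6"
      then have e: "tot e = 3 * (m + 2) + 1" and "tot d mod 3 = 1"
        by (simp, presburger)
      with assms(5) spread_cases1[OF assms(1) t(1)] spread_cases1[OF assms(2) e]
      show ?thesis
        unfolding P_def spread_def all_idx stuck_def prod.inject
        by (elim disjE conjE; simp add: tot_def)
    next
      assume t: "tot d = 3 * m + 2" "tot e = tot d + 4"
      then have e: "tot e = 3 * (m + 2)" and "tot d mod 3 = 2"
        by (simp, presburger)
      with assms(5) spread_cases2[OF assms(1) t(1)] spread_cases0[OF assms(2) e]
      show ?thesis
        unfolding P_def spread_def all_idx stuck_def prod.inject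
        by (elim disjE conjE; simp add: tot_def)
    next
      assume t: "tot d = 3 * m + 2" "tot e = tot d + 6"
      then have e: "tot e = 3 * (m + 2) + 2" and "tot d mod 3 = 2"
        by (simp, presburger)
      with assms(5) spread_cases2[OF assms(1) t(1)] spread_cases2[OF assms(2) e]
      show ?thesis
        unfolding P_def spread_def all_idx stuck_def prod.inject
        by (elim disjE conjE; simp add: tot_def)
    qed
    then show ?thesis by blast
  qed
  then show thesis
    using that unfolding P_def by blast
qed

text \<open>Each inequality is an affine minorant of \<open>t\<^sup>2\<close> found by interpolation at the four vertices of a simplex
  cell. Here \<open>\<tau>\<close> is the total and \<open>\<delta>\<close> a coordinate of a vector with spread at most 1, both translated
  such that \<open>\<tau>\<close> is odd.\<close>
lemma simplex_minorants:
  fixes \<tau> \<delta> :: int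
  assumes "odd \<tau>" "\<bar>\<tau> - 3 * \<delta>\<bar> \<le> 2"
  shows cert_A: "24 * \<delta> - 23 \<le> \<tau>\<^sup>2"
    and cert_A_eq: "24 * \<delta> - 23 = \<tau>\<^sup>2 \<Longrightarrow> (\<tau>, \<delta>) \<in> {(1, 1), (5, 2), (7, 3)}"
    and cert_C: "12 * \<tau> - 24 * \<delta> - 11 \<le> \<tau>\<^sup>2"
    and cert_C_eq: "12 * \<tau> - 24 * \<delta> - 11 = \<tau>\<^sup>2 \<Longrightarrow> (\<tau>, \<delta>) \<in> {(-1, -1), (1, 0), (5, 1)}"
    and cert_B1: "8 * (\<tau> - \<delta>) - 7 \<le> \<tau>\<^sup>2"
    and cert_B1_eq: "8 * (\<tau> - \<delta>) - 7 = \<tau>\<^sup>2 \<Longrightarrow> (\<tau>, \<delta>) \<in> {(1, 0), (3, 1), (5, 1)}"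
    and cert_B2: "4 * \<tau> + 8 * \<delta> - 11 \<le> \<tau>\<^sup>2"
    and cert_B2_eq: "4 * \<tau> + 8 * \<delta> - 11 = \<tau>\<^sup>2 \<Longrightarrow> (\<tau>, \<delta>) \<in> {(1, 1), (3, 1), (5, 2)}"
proof -
  have *: "24 * \<delta> - 23 \<le> \<tau>\<^sup>2 \<and> (24 * \<delta> - 23 = \<tau>\<^sup>2 \<longrightarrow> (\<tau>, \<delta>) \<in> {(1, 1), (5, 2), (7, 3)}) \<and>
    12 * \<tau> - 24 * \<delta> - 11 \<le> \<tau>\<^sup>2 \<and> (12 * \<tau> - 24 * \<delta> - 11 = \<tau>\<^sup>2 \<longrightarrow> (\<tau>, \<delta>) \<in> {(-1, -1), (1, 0), (5, 1)}) \<and>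
    8 * (\<tau> - \<delta>) - 7 \<le> \<tau>\<^sup>2 \<and> (8 * (\<tau> - \<delta>) - 7 = \<tau>\<^sup>2 \<longrightarrow> (\<tau>, \<delta>) \<in> {(1, 0), (3, 1), (5, 1)}) \<and>
    4 * \<tau> + 8 * \<delta> - 11 \<le> \<tau>\<^sup>2 \<and> (4 * \<tau> + 8 * \<delta> - 11 = \<tau>\<^sup>2 \<longrightarrow> (\<tau>, \<delta>) \<in> {(1, 1), (3, 1), (5, 2)})"
  proof -
    \<comment> \<open>Since \<delta> is within 2/3 of \<tau>/3, the square dominates all four linear
      functions for large \<bar>\<tau>\<bar>. A finite check remains.\<close>
    consider "\<tau> \<ge> 10" | "\<tau> \<le> -2" | "-2 < \<tau>" "\<tau> < 10"
      by linarith
    then show ?thesis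
    proof cases
      case 1
      then have "\<tau> * 10 \<le> \<tau>\<^sup>2"
        unfolding power2_eq_square by (intro mult_left_mono) auto
      then show ?thesis using 1 assms(2) by auto
    next
      case 2
      then have "0 \<le> (- \<tau>) * (-2 - \<tau>)"
        by (intro mult_nonneg_nonneg) auto
      then have "\<tau>\<^sup>2 \<ge> - 2 * \<tau>"
        by (simp add: power2_eq_square algebra_simps)
      then show ?thesis using 2 assms(2) by auto
    next
      case 3
      have "\<tau> \<in> {-1, 1, 3, 5, 7, 9}"
        using 3 assms(1) by (simp, presburger)
      moreover have "-1 \<le> \<delta>" "\<delta> \<le> 3"
        using 3 assms(2) by linarith+
      then have "\<delta> \<in> {-1, 0, 1, 2, 3}" by auto
      ultimately show ?thesis using assms(2) by (elim insertE emptyE) simp_all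
    qed
  qed
  show "24 * \<delta> - 23 \<le> \<tau>\<^sup>2" "24 * \<delta> - 23 = \<tau>\<^sup>2 \<Longrightarrow> (\<tau>, \<delta>) \<in> {(1, 1), (5, 2), (7, 3)}"
    "12 * \<tau> - 24 * \<delta> - 11 \<le> \<tau>\<^sup>2" "12 * \<tau> - 24 * \<delta> - 11 = \<tau>\<^sup>2 \<Longrightarrow> (\<tau>, \<delta>) \<in> {(-1, -1), (1, 0), (5, 1)}"
    "8 * (\<tau> - \<delta>) - 7 \<le> \<tau>\<^sup>2" "8 * (\<tau> - \<delta>) - 7 = \<tau>\<^sup>2 \<Longrightarrow> (\<tau>, \<delta>) \<in> {(1, 0), (3, 1), (5, 1)}"
    "4 * \<tau> + 8 * \<delta> - 11 \<le> \<tau>\<^sup>2" "4 * \<tau> + 8 * \<delta> - 11 = \<tau>\<^sup>2 \<Longrightarrow> (\<tau>, \<delta>) \<in> {(1, 1), (3, 1), (5, 2)}"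
    using * by blast+
qed

section \<open>Cells, barycentric uniqueness and affine certificates\<close>

definition octa :: "int \<Rightarrow> int \<Rightarrow> idx \<Rightarrow> idx \<Rightarrow> int" where
  "octa \<mu> c i = (\<lambda>j. if j = i then \<mu> + c else \<mu>)"

text \<open>The end states of the rebalancing. Totals of equal parity closer than 4 differ by at
  most 2, and then no even transfer fits strictly in between.\<close>

definition stable :: "(idx \<Rightarrow> int) multiset \<Rightarrow> bool" where
  "stable X \<longleftrightarrow> (\<forall>d\<in>#X. \<forall>e\<in>#X. tot d + 4 \<le> tot e \<longrightarrow> stuck d e)"

lemma replicate4:
  assumes "set_mset X \<subseteq> {p1, p2, p3, p4}"
  obtains a b c d where "X = replicate_mset a p1 + replicate_mset b p2 + replicate_mset c p3 + replicate_mset d p4"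
proof -
  have "\<exists>a b c d. X = replicate_mset a p1 + replicate_mset b p2 + replicate_mset c p3 + replicate_mset d p4"
    using assms
  proof (induction X)
    case empty
    then show ?case by (intro exI[of _ 0]) simp
  next
    case (add x X)
    then obtain a b c d where X: "X = replicate_mset a p1 + replicate_mset b p2 + replicate_mset c p3 + replicate_mset d p4"
      by auto
    consider "x = p1" | "x = p2" | "x = p3" | "x = p4" using add.prems by auto
    then show ?case
    proof cases
      case 1 then show ?thesis unfolding X by (intro exI[of _ "Suc a"] exI[of _ b] exI[of _ c] exI[of _ d]) simp
    next
      case 2 then show ?thesis unfolding X by (intro exI[of _ a] exI[of _ "Suc b"] exI[of _ c] exI[of _ d]) simp
    next
      case 3 then show ?thesis unfolding X by (intro exI[of _ a] exI[of _ b] exI[of _ "Suc c"] exI[of _ d]) simp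
    next
      case 4 then show ?thesis unfolding X by (intro exI[of _ a] exI[of _ b] exI[of _ c] exI[of _ "Suc d"]) simp
    qed
  qed
  then show thesis using that by blast
qed

lemma sum_mset_replicate: "(\<Sum>x\<in>#replicate_mset n p. f x) = int n * f p" for f :: "'b \<Rightarrow> int"
  by (induction n) (auto simp: algebra_simps)

text \<open>Multiplicities on the vertices of a simplex are barycentric coordinates, hence fixed by
  size and sum. Hypothesis \<open>ind\<close> is affine independence, and the translation by
  \<open>m\<close> turns it into a linear system with numerical coefficients.\<close>

lemma simplex_unique:
  fixes X Y :: "('i \<Rightarrow> int) multiset"
  assumes "set_mset X \<subseteq> {p1, p2, p3, p4}" "set_mset Y \<subseteq> {p1, p2, p3, p4}"
    and "size X = size Y" "\<And>i. (\<Sum>x\<in>#X. x i) = (\<Sum>x\<in>#Y. x i)"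
    and ind: "\<And>z1 z2 z3 z4 :: int. z1 + z2 + z3 + z4 = 0 \<Longrightarrow>
       (\<And>i. z1 * (p1 i - m) + z2 * (p2 i - m) + z3 * (p3 i - m) + z4 * (p4 i - m) = 0) \<Longrightarrow>
       z1 = 0 \<and> z2 = 0 \<and> z3 = 0 \<and> z4 = 0"
  shows "X = Y"
proof -
  obtain a b c d where X: "X = replicate_mset a p1 + replicate_mset b p2 + replicate_mset c p3 + replicate_mset d p4"
    using replicate4[OF assms(1)] .
  obtain a' b' c' d' where Y: "Y = replicate_mset a' p1 + replicate_mset b' p2 + replicate_mset c' p3 + replicate_mset d' p4"
    using replicate4[OF assms(2)] .
  define z1 z2 z3 z4 where z: "z1 = int a - int a'" "z2 = int b - int b'" "z3 = int c - int c'" "z4 = int d - int d'"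
  have s: "z1 + z2 + z3 + z4 = 0"
    using assms(3) unfolding X Y z by simp
  have "z1 * p1 i + z2 * p2 i + z3 * p3 i + z4 * p4 i = 0" for i
    using assms(4)[of i] unfolding X Y z by (simp add: sum_mset_replicate algebra_simps)
  moreover have "(z1 + z2 + z3 + z4) * m = 0"
    using s by simp
  ultimately have "z1 * (p1 i - m) + z2 * (p2 i - m) + z3 * (p3 i - m) + z4 * (p4 i - m) = 0" for i
    by (simp add: algebra_simps)
  from ind[OF s this] show ?thesis
    unfolding X Y z by simp
qed

text \<open>Complementary slackness. The affine function has the same sum over \<open>X\<close> and
  \<open>Y\<close>; it equals \<open>f\<close> on \<open>X\<close> and lies below \<open>f\<close>
  on \<open>Y\<close>, while the sum of \<open>f\<close> over \<open>Y\<close> is no larger. So no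
  point of \<open>Y\<close> can have a positive gap.\<close>

lemma affine_certificate:
  fixes X Y :: "(idx \<Rightarrow> int) multiset" and f :: "(idx \<Rightarrow> int) \<Rightarrow> int"
  assumes "size X = size Y" "\<And>i. (\<Sum>x\<in>#X. x i) = (\<Sum>x\<in>#Y. x i)"
    and le: "(\<Sum>x\<in>#Y. f x) \<le> (\<Sum>x\<in>#X. f x)"
    and X: "\<And>x. x \<in># X \<Longrightarrow> f x = \<alpha> + \<beta> * tot x + \<gamma> * x k"
    and Y: "\<And>x. x \<in># Y \<Longrightarrow> \<alpha> + \<beta> * tot x + \<gamma> * x k \<le> f x"
    and "y \<in># Y"
  shows "f y = \<alpha> + \<beta> * tot y + \<gamma> * y k"
proof -
  have tot_sum: "(\<Sum>x\<in>#M. tot x) = (\<Sum>x\<in>#M. x I1) + (\<Sum>x\<in>#M. x I2) + (\<Sum>x\<in>#M. x I3)" for M :: "(idx \<Rightarrow> int) multiset"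
    unfolding tot_def by (simp add: sum_mset.distrib)
  have L: "(\<Sum>x\<in>#M. \<alpha> + \<beta> * tot x + \<gamma> * x k) = \<alpha> * int (size M) + \<beta> * (\<Sum>x\<in>#M. tot x) + \<gamma> * (\<Sum>x\<in>#M. x k)" for M
    by (induction M) (auto simp: algebra_simps)
  have "(\<Sum>x\<in>#X. f x) = (\<Sum>x\<in>#X. \<alpha> + \<beta> * tot x + \<gamma> * x k)"
    using X by (intro arg_cong[of _ _ sum_mset] image_mset_cong) auto
  also have "\<dots> = (\<Sum>x\<in>#Y. \<alpha> + \<beta> * tot x + \<gamma> * x k)"
    unfolding L tot_sum assms(1,2) ..
  finally have le': "(\<Sum>x\<in>#Y. f x) \<le> (\<Sum>x\<in>#Y. \<alpha> + \<beta> * tot x + \<gamma> * x k)"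
    using le by simp
  obtain M where M: "Y = add_mset y M"
    using \<open>y \<in># Y\<close> by (metis insert_DiffM)
  have "(\<Sum>x\<in>#M. \<alpha> + \<beta> * tot x + \<gamma> * x k) \<le> (\<Sum>x\<in>#M. f x)"
    using Y M by (intro sum_mset_mono) auto
  then show ?thesis
    using le' Y[OF \<open>y \<in># Y\<close>] unfolding M by simp
qed

section \<open>Vectors in cyclic coordinates\<close>

lemma ex_idx: "(\<exists>i. P i) \<longleftrightarrow> P I1 \<or> P I2 \<or> P I3"
  by (metis idx.exhaust)

fun nx :: "idx \<Rightarrow> idx" where
  "nx I1 = I2" | "nx I2 = I3" | "nx I3 = I1"

lemma all_idx_nx: "(\<forall>i. P i) \<longleftrightarrow> P k \<and> P (nx k) \<and> P (nx (nx k))"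
  by (cases k) (auto simp: all_idx)

lemma tot_nx: "tot x = x k + x (nx k) + x (nx (nx k))" for x :: "idx \<Rightarrow> 'a::comm_monoid_add"
  by (cases k) (auto simp: tot_def ac_simps)

lemma nx_neq [simp]: "nx k \<noteq> k" "k \<noteq> nx k" "nx (nx k) \<noteq> k" "k \<noteq> nx (nx k)"
  "nx (nx k) \<noteq> nx k" "nx k \<noteq> nx (nx k)"
  by (cases k; simp)+

text \<open>The entries are listed cyclically from \<open>k\<close>, so that a single statement
  covers all positions of a distinguished coordinate.\<close>

definition vec :: "idx \<Rightarrow> int \<Rightarrow> int \<Rightarrow> int \<Rightarrow> idx \<Rightarrow> int" where
  "vec k a b c = (\<lambda>i. if i = k then a else if i = nx k then b else c)"

lemma vec_simps [simp]:
  "vec k a b c k = a" "vec k a b c (nx k) = b" "vec k a b c (nx (nx k)) = c"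
  by (simp_all add: vec_def)

lemma eq_vec_iff: "x = vec k a b c \<longleftrightarrow> x k = a \<and> x (nx k) = b \<and> x (nx (nx k)) = c"
  unfolding fun_eq_iff by (subst all_idx_nx[of _ k]) simp

lemma octa_vec: "octa \<mu> c i = vec i (\<mu> + c) \<mu> \<mu>"
  by (simp add: fun_eq_iff octa_def vec_def)

lemma spread_nx: "spread x \<longleftrightarrow> x k \<le> x (nx k) + 1 \<and> x k \<le> x (nx (nx k)) + 1 \<and>
    x (nx k) \<le> x k + 1 \<and> x (nx k) \<le> x (nx (nx k)) + 1 \<and>
    x (nx (nx k)) \<le> x k + 1 \<and> x (nx (nx k)) \<le> x (nx k) + 1"
  unfolding spread_def all_idx_nx[of _ k] by auto

lemma vec_unique:
  fixes X Y :: "(idx \<Rightarrow> int) multiset"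
  assumes "set_mset X \<subseteq> {vec k a1 b1 c1, vec k a2 b2 c2, vec k a3 b3 c3, vec k a4 b4 c4}"
    and "set_mset Y \<subseteq> {vec k a1 b1 c1, vec k a2 b2 c2, vec k a3 b3 c3, vec k a4 b4 c4}"
    and "size X = size Y" "\<And>i. (\<Sum>x\<in>#X. x i) = (\<Sum>x\<in>#Y. x i)"
    and "\<And>z1 z2 z3 z4 :: int. z1 + z2 + z3 + z4 = 0 \<Longrightarrow>
       z1 * (a1 - m) + z2 * (a2 - m) + z3 * (a3 - m) + z4 * (a4 - m) = 0 \<Longrightarrow>
       z1 * (b1 - m) + z2 * (b2 - m) + z3 * (b3 - m) + z4 * (b4 - m) = 0 \<Longrightarrow>
       z1 * (c1 - m) + z2 * (c2 - m) + z3 * (c3 - m) + z4 * (c4 - m) = 0 \<Longrightarrow>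
       z1 = 0 \<and> z2 = 0 \<and> z3 = 0 \<and> z4 = 0"
  shows "X = Y"
proof (rule simplex_unique[OF assms(1-4), of m])
  fix z1 z2 z3 z4 :: int
  assume "z1 + z2 + z3 + z4 = 0"
  moreover assume *: "\<And>i. z1 * (vec k a1 b1 c1 i - m) + z2 * (vec k a2 b2 c2 i - m) +
    z3 * (vec k a3 b3 c3 i - m) + z4 * (vec k a4 b4 c4 i - m) = 0"
  ultimately show "z1 = 0 \<and> z2 = 0 \<and> z3 = 0 \<and> z4 = 0"
    using *[of k] *[of "nx k"] *[of "nx (nx k)"] by (intro assms(5)) simp_all
qed

section \<open>Multisets of equal size and sum on a common cell\<close>

context
  fixes X Y :: "(idx \<Rightarrow> int) multiset" and m :: int and k :: idx
  assumes size: "size X = size Y" and sums: "\<And>i. (\<Sum>x\<in>#X. x i) = (\<Sum>x\<in>#Y. x i)"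
begin

text \<open>The cell of a pair \<open>d\<close>, \<open>d + (2,2,2)\<close> with
  \<open>tot d\<close> equal to 1 modulo 3: the two ends and two vectors of total
  \<open>3 * m + 5\<close>.\<close>

lemma cell_unique_A:
  assumes "\<And>x. x \<in># X + Y \<Longrightarrow> spread x"
    and "\<And>x. x \<in># X + Y \<Longrightarrow> (tot x - 3 * m, x k - m) \<in> {(1, 1), (5, 2), (7, 3)}"
  shows "X = Y"
proof -
  have "x \<in> {vec k (m + 1) m m, vec k (m + 2) (m + 2) (m + 1), vec k (m + 2) (m + 1) (m + 2), vec k (m + 3) (m + 2) (m + 2)}"
    if "x \<in># X + Y" for x
    using assms(2)[OF that, unfolded insert_iff empty_iff prod.inject]
  proof (elim disjE conjE FalseE)
    assume "tot x - 3 * m = 1" "x k - m = 1"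
    then show ?thesis
      using spread_floor[OF assms(1)[OF that], of "m" "nx k"]
        spread_floor[OF assms(1)[OF that], of "m" "nx (nx k)"] tot_nx[of x k]
      by (auto simp: eq_vec_iff)
  next
    assume "tot x - 3 * m = 5" "x k - m = 2"
    then show ?thesis
      using spread_floor[OF assms(1)[OF that], of "m + 1" "nx k"]
        spread_floor[OF assms(1)[OF that], of "m + 1" "nx (nx k)"] tot_nx[of x k]
      by (auto simp: eq_vec_iff)
  next
    assume "tot x - 3 * m = 7" "x k - m = 3"
    then show ?thesis
      using spread_floor[OF assms(1)[OF that], of "m + 2" "nx k"]
        spread_floor[OF assms(1)[OF that], of "m + 2" "nx (nx k)"] tot_nx[of x k]
      by (auto simp: eq_vec_iff)
  qed
  then show ?thesis
    by (intro vec_unique[OF _ _ size sums, of k "m + 1" m m "m + 2" "m + 2" "m + 1" "m + 2" "m + 1" "m + 2" "m + 3" "m + 2" "m + 2" m]) auto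
qed

text \<open>Reflecting every coordinate by \<open>2 * m + 2 - x\<close> turns this cell into the one
  of \<open>cell_unique_A\<close>.\<close>

lemma cell_unique_C:
  assumes "\<And>x. x \<in># X + Y \<Longrightarrow> spread x"
    and "\<And>x. x \<in># X + Y \<Longrightarrow> (tot x - 3 * m, x k - m) \<in> {(-1, -1), (1, 0), (5, 1)}"
  shows "X = Y"
proof -
  have "x \<in> {vec k (m - 1) m m, vec k m (m + 1) m, vec k m m (m + 1), vec k (m + 1) (m + 2) (m + 2)}"
    if "x \<in># X + Y" for x
    using assms(2)[OF that, unfolded insert_iff empty_iff prod.inject]
  proof (elim disjE conjE FalseE)
    assume "tot x - 3 * m = -1" "x k - m = -1"
    then show ?thesis
      using spread_floor[OF assms(1)[OF that], of "m - 1" "nx k"]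
        spread_floor[OF assms(1)[OF that], of "m - 1" "nx (nx k)"] tot_nx[of x k]
      by (auto simp: eq_vec_iff)
  next
    assume "tot x - 3 * m = 1" "x k - m = 0"
    then show ?thesis
      using spread_floor[OF assms(1)[OF that], of "m" "nx k"]
        spread_floor[OF assms(1)[OF that], of "m" "nx (nx k)"] tot_nx[of x k]
      by (auto simp: eq_vec_iff)
  next
    assume "tot x - 3 * m = 5" "x k - m = 1"
    then show ?thesis
      using spread_floor[OF assms(1)[OF that], of "m + 1" "nx k"]
        spread_floor[OF assms(1)[OF that], of "m + 1" "nx (nx k)"] tot_nx[of x k]
      by (auto simp: eq_vec_iff)
  qed
  then show ?thesis
    by (intro vec_unique[OF _ _ size sums, of k "m - 1" m m m "m + 1" m m m "m + 1" "m + 1" "m + 2" "m + 2" m]) auto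
qed

text \<open>A cell around the constant vector \<open>m + 1\<close>, with two vertices of lower and
  one of higher total.\<close>

lemma cell_unique_B1:
  assumes "\<And>x. x \<in># X + Y \<Longrightarrow> spread x"
    and "\<And>x. x \<in># X + Y \<Longrightarrow> (tot x - 3 * m, x k - m) \<in> {(1, 0), (3, 1), (5, 1)}"
  shows "X = Y"
proof -
  have "x \<in> {vec k m (m + 1) m, vec k m m (m + 1), vec k (m + 1) (m + 1) (m + 1), vec k (m + 1) (m + 2) (m + 2)}"
    if "x \<in># X + Y" for x
    using assms(2)[OF that, unfolded insert_iff empty_iff prod.inject]
  proof (elim disjE conjE FalseE)
    assume "tot x - 3 * m = 1" "x k - m = 0"
    then show ?thesis
      using spread_floor[OF assms(1)[OF that], of "m" "nx k"]
        spread_floor[OF assms(1)[OF that], of "m" "nx (nx k)"] tot_nx[of x k]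
      by (auto simp: eq_vec_iff)
  next
    assume "tot x - 3 * m = 3" "x k - m = 1"
    then show ?thesis
      using spread_floor[OF assms(1)[OF that], of "m + 1" "nx k"]
        spread_floor[OF assms(1)[OF that], of "m + 1" "nx (nx k)"] tot_nx[of x k]
      by (auto simp: eq_vec_iff)
  next
    assume "tot x - 3 * m = 5" "x k - m = 1"
    then show ?thesis
      using spread_floor[OF assms(1)[OF that], of "m + 1" "nx k"]
        spread_floor[OF assms(1)[OF that], of "m + 1" "nx (nx k)"] tot_nx[of x k]
      by (auto simp: eq_vec_iff)
  qed
  then show ?thesis
    by (intro vec_unique[OF _ _ size sums, of k m "m + 1" m m m "m + 1" "m + 1" "m + 1" "m + 1" "m + 1" "m + 2" "m + 2" m]) auto
qed

text \<open>The reflection \<open>2 * m + 2 - x\<close> of the cell in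
  \<open>cell_unique_B1\<close>: one vertex of lower and two of higher total.\<close>

lemma cell_unique_B2:
  assumes "\<And>x. x \<in># X + Y \<Longrightarrow> spread x"
    and "\<And>x. x \<in># X + Y \<Longrightarrow> (tot x - 3 * m, x k - m) \<in> {(1, 1), (3, 1), (5, 2)}"
  shows "X = Y"
proof -
  have "x \<in> {vec k (m + 1) m m, vec k (m + 1) (m + 1) (m + 1), vec k (m + 2) (m + 2) (m + 1), vec k (m + 2) (m + 1) (m + 2)}"
    if "x \<in># X + Y" for x
    using assms(2)[OF that, unfolded insert_iff empty_iff prod.inject]
  proof (elim disjE conjE FalseE)
    assume "tot x - 3 * m = 1" "x k - m = 1"
    then show ?thesis
      using spread_floor[OF assms(1)[OF that], of "m" "nx k"]
        spread_floor[OF assms(1)[OF that], of "m" "nx (nx k)"] tot_nx[of x k]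
      by (auto simp: eq_vec_iff)
  next
    assume "tot x - 3 * m = 3" "x k - m = 1"
    then show ?thesis
      using spread_floor[OF assms(1)[OF that], of "m + 1" "nx k"]
        spread_floor[OF assms(1)[OF that], of "m + 1" "nx (nx k)"] tot_nx[of x k]
      by (auto simp: eq_vec_iff)
  next
    assume "tot x - 3 * m = 5" "x k - m = 2"
    then show ?thesis
      using spread_floor[OF assms(1)[OF that], of "m + 1" "nx k"]
        spread_floor[OF assms(1)[OF that], of "m + 1" "nx (nx k)"] tot_nx[of x k]
      by (auto simp: eq_vec_iff)
  qed
  then show ?thesis
    by (intro vec_unique[OF _ _ size sums, of k "m + 1" m m "m + 1" "m + 1" "m + 1" "m + 2" "m + 2" "m + 1" "m + 2" "m + 1" "m + 2" m]) auto
qed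

text \<open>If one of the totals \<open>s\<close>, \<open>s + 2\<close> is divisible by 3, it allows
  one constant vector and the other total allows three vectors, which gives a simplex. If neither
  is, three vectors of each total form an octahedron, whose vertices are affinely dependent.\<close>

lemma cell_unique_tight:
  assumes "\<And>x. x \<in># X + Y \<Longrightarrow> spread x"
    and "\<And>x. x \<in># X + Y \<Longrightarrow> tot x = s \<or> tot x = s + 2"
  shows "X = Y \<or> (\<exists>\<mu>. \<forall>x\<in>#X + Y. \<exists>i. x = octa \<mu> 1 i \<or> x = octa \<mu> (-1) i)"
proof -
  define m where "m = s div 3"
  have "s = 3 * m \<or> s = 3 * m + 1 \<or> s = 3 * m + 2"
    unfolding m_def by presburger
  then consider "s = 3 * m" | "s = 3 * m + 1" | "s = 3 * m + 2"
    by blast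
  then show ?thesis
  proof cases
    case 1
    have "x \<in> {vec I1 m m m, vec I1 m (m + 1) (m + 1), vec I1 (m + 1) m (m + 1), vec I1 (m + 1) (m + 1) m}"
      if "x \<in># X + Y" for x
      using assms(2)[OF that]
    proof
      assume "tot x = s"
      then show ?thesis
        using 1 spread_floor[OF assms(1)[OF that], of "m" I1] spread_floor[OF assms(1)[OF that], of "m" I2]
          spread_floor[OF assms(1)[OF that], of "m" I3]
        by (auto simp: eq_vec_iff tot_def)
    next
      assume "tot x = s + 2"
      then show ?thesis
        using 1 spread_floor[OF assms(1)[OF that], of "m" I1] spread_floor[OF assms(1)[OF that], of "m" I2]
          spread_floor[OF assms(1)[OF that], of "m" I3]
        by (auto simp: eq_vec_iff tot_def)
    qed
    then have "X = Y"
      by (intro vec_unique[OF _ _ size sums, of I1 m m m m "m + 1" "m + 1" "m + 1" m "m + 1" "m + 1" "m + 1" m m]) auto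
    then show ?thesis ..
  next
    case 2
    have "x \<in> {vec I1 (m + 1) (m + 1) (m + 1), vec I1 (m + 1) m m, vec I1 m (m + 1) m, vec I1 m m (m + 1)}"
      if "x \<in># X + Y" for x
      using assms(2)[OF that]
    proof
      assume "tot x = s"
      then show ?thesis
        using 2 spread_floor[OF assms(1)[OF that], of "m" I1] spread_floor[OF assms(1)[OF that], of "m" I2]
          spread_floor[OF assms(1)[OF that], of "m" I3]
        by (auto simp: eq_vec_iff tot_def)
    next
      assume "tot x = s + 2"
      then show ?thesis
        using 2 spread_floor[OF assms(1)[OF that], of "m + 1" I1] spread_floor[OF assms(1)[OF that], of "m + 1" I2]
          spread_floor[OF assms(1)[OF that], of "m + 1" I3]
        by (auto simp: eq_vec_iff tot_def)
    qed
    then have "X = Y"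
      by (intro vec_unique[OF _ _ size sums, of I1 "m + 1" "m + 1" "m + 1" "m + 1" m m m "m + 1" m m m "m + 1" m]) auto
    then show ?thesis ..
  next
    case 3
    have "\<exists>i. x = octa (m + 1) 1 i \<or> x = octa (m + 1) (-1) i" if "x \<in># X + Y" for x
    proof -
      have "\<exists>i. x = vec i (m + 1 + 1) (m + 1) (m + 1) \<or> x = vec i (m + 1 + - 1) (m + 1) (m + 1)"
        using assms(2)[OF that]
      proof
        assume "tot x = s"
        then show ?thesis
          using 3 spread_floor[OF assms(1)[OF that], of "m" I1] spread_floor[OF assms(1)[OF that], of "m" I2]
            spread_floor[OF assms(1)[OF that], of "m" I3]
          unfolding ex_idx by (auto simp: eq_vec_iff tot_def)
      next
        assume "tot x = s + 2"
        then show ?thesis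
          using 3 spread_floor[OF assms(1)[OF that], of "m + 1" I1] spread_floor[OF assms(1)[OF that], of "m + 1" I2]
            spread_floor[OF assms(1)[OF that], of "m + 1" I3]
          unfolding ex_idx by (auto simp: eq_vec_iff tot_def)
      qed
      then show ?thesis
        unfolding octa_vec .
    qed
    then show ?thesis by blast
  qed
qed

end

text \<open>Applies \<open>affine_certificate\<close> to a minorant stated in the translated
  coordinates \<tau> and \<delta>. The set \<open>S\<close> collects its points of contact with the
  square, so \<open>Y\<close> is confined to the cell on which \<open>X\<close> lies.\<close>

lemma certificate_spread:
  fixes X Y :: "(idx \<Rightarrow> int) multiset" and a b c m :: int
  assumes "size X = size Y" "\<And>i. (\<Sum>x\<in>#X. x i) = (\<Sum>x\<in>#Y. x i)"
    and "(\<Sum>x\<in>#Y. (tot x)\<^sup>2) \<le> (\<Sum>x\<in>#X. (tot x)\<^sup>2)"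
    and odd: "\<And>x. x \<in># Y \<Longrightarrow> odd (tot x - 3 * m)"
    and spread: "\<And>x. x \<in># Y \<Longrightarrow> spread x"
    and le: "\<And>\<tau> \<delta>. odd \<tau> \<Longrightarrow> \<bar>\<tau> - 3 * \<delta>\<bar> \<le> 2 \<Longrightarrow> a + b * \<tau> + c * \<delta> \<le> \<tau>\<^sup>2"
    and eq: "\<And>\<tau> \<delta>. odd \<tau> \<Longrightarrow> \<bar>\<tau> - 3 * \<delta>\<bar> \<le> 2 \<Longrightarrow> a + b * \<tau> + c * \<delta> = \<tau>\<^sup>2 \<Longrightarrow> (\<tau>, \<delta>) \<in> S"
    and tight: "\<And>x. x \<in># X \<Longrightarrow> a + b * (tot x - 3 * m) + c * (x k - m) = (tot x - 3 * m)\<^sup>2"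
    and y: "y \<in># Y"
  shows "(tot y - 3 * m, y k - m) \<in> S"
proof -
  \<comment> \<open>Expanding the translated minorant and adding
    \<open>6 * m * tot x - 9 * m^2\<close>, the difference between the square of
    \<open>tot x\<close> and that of \<open>tot x - 3 * m\<close>, gives these coefficients.\<close>
  let ?\<alpha> = "a - 3 * m * b - m * c - 9 * m\<^sup>2" and ?\<beta> = "b + 6 * m"
  have L: "?\<alpha> + ?\<beta> * tot x + c * x k - (tot x)\<^sup>2 =
      a + b * (tot x - 3 * m) + c * (x k - m) - (tot x - 3 * m)\<^sup>2" for x
    by (simp add: algebra_simps power2_eq_square)
  have dist: "\<bar>(tot x - 3 * m) - 3 * (x k - m)\<bar> \<le> 2" if "x \<in># Y" for x
    using spread[OF that] unfolding spread_nx[of _ k] tot_nx[of _ k] by (auto simp: abs_le_iff)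
  have "(tot y)\<^sup>2 = ?\<alpha> + ?\<beta> * tot y + c * y k"
  proof (rule affine_certificate[OF assms(1-3) _ _ y])
    show "(tot x)\<^sup>2 = ?\<alpha> + ?\<beta> * tot x + c * x k" if "x \<in># X" for x
      using tight[OF that] L[of x] by linarith
    show "?\<alpha> + ?\<beta> * tot x + c * x k \<le> (tot x)\<^sup>2" if "x \<in># Y" for x
      using le[OF odd[OF that] dist[OF that]] L[of x] by linarith
  qed
  then show ?thesis
    using eq[OF odd[OF y] dist[OF y]] L[of y] by linarith
qed

text \<open>A vector with minimal total and one with maximal total determine the cell, up to one further choice
  if these totals differ by 4.\<close>
lemma stable_unique:
  fixes X Y :: "(idx \<Rightarrow> int) multiset"
  assumes size: "size X = size Y" and sums: "\<And>i. (\<Sum>x\<in>#X. x i) = (\<Sum>x\<in>#Y. x i)"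
    and le: "(\<Sum>x\<in>#Y. (tot x)\<^sup>2) \<le> (\<Sum>x\<in>#X. (tot x)\<^sup>2)"
    and spread: "\<And>x. x \<in># X + Y \<Longrightarrow> spread x"
    and parity: "\<And>x. x \<in># X + Y \<Longrightarrow> even (tot x - r)"
    and "stable X"
  shows "X = Y \<or> (\<exists>\<mu>. \<forall>x\<in>#X + Y. \<exists>i. x = octa \<mu> 1 i \<or> x = octa \<mu> (-1) i)"
proof (cases "X = {#}")
  case True
  then show ?thesis using size by simp
next
  case False
  then have "tot ` set_mset X \<noteq> {}" "finite (tot ` set_mset X)" by auto
  then have "Min (tot ` set_mset X) \<in> tot ` set_mset X" "Max (tot ` set_mset X) \<in> tot ` set_mset X"
    using Min_in Max_in by blast+
  then obtain d e where "d \<in># X" "tot d = Min (tot ` set_mset X)" "e \<in># X" "tot e = Max (tot ` set_mset X)"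
    by (metis imageE)
  then have d: "d \<in># X" "\<And>x. x \<in># X \<Longrightarrow> tot d \<le> tot x"
    and e: "e \<in># X" "\<And>x. x \<in># X \<Longrightarrow> tot x \<le> tot e"
    by auto
  have par: "even (tot x - tot d)" if "x \<in># X + Y" for x
  proof -
    have "even (tot d - r)" using parity d(1) by simp
    then show ?thesis using parity[OF that] by presburger
  qed
  have parX: "even (tot x - tot d)" if "x \<in># X" for x using par that by simp
  have parY: "even (tot x - tot d)" if "x \<in># Y" for x using par that by simp
  have stuck: "stuck x y" if "x \<in># X" "y \<in># X" "tot x + 4 \<le> tot y" for x y
    using \<open>stable X\<close> that unfolding stable_def by blast
  have spreadX: "spread x" if "x \<in># X" for x using spread that by simp
  have spreadY: "spread x" if "x \<in># Y" for x using spread that by simp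
  define m where "m = tot d div 3"
  have "tot e \<le> tot d + 2 \<or> tot d + 4 \<le> tot e"
    using parX[OF e(1)] by presburger
  then consider (tight) "tot e \<le> tot d + 2" | (gap) "tot d + 4 \<le> tot e"
    by blast
  then show ?thesis
  proof cases
    case tight
    have X: "tot x = tot d \<or> tot x = tot d + 2" if "x \<in># X" for x
      using d(2)[OF that] e(2)[OF that] tight parX[OF that] by presburger
    have "tot x = tot d \<or> tot x = tot d + 2" if x: "x \<in># Y" for x
    proof -
      let ?s = "tot d"
      \<comment> \<open>The certificate is the chord of the square through \<open>?s\<close> and
        \<open>?s + 2\<close>. The product on the right is nonnegative at all \<open>t\<close> of
        the parity of \<open>?s\<close>.\<close>
      have fact: "t\<^sup>2 - (- (?s * (?s + 2)) + (2 * ?s + 2) * t) = (t - ?s) * (t - ?s - 2)" for t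
        by (simp add: algebra_simps power2_eq_square)
      have "(tot x)\<^sup>2 = - (?s * (?s + 2)) + (2 * ?s + 2) * tot x + 0 * x I1"
      proof (rule affine_certificate[OF size sums le _ _ x])
        show "(tot y)\<^sup>2 = - (?s * (?s + 2)) + (2 * ?s + 2) * tot y + 0 * y I1" if "y \<in># X" for y
          using X[OF that] fact[of "tot y"] by auto
        show "- (?s * (?s + 2)) + (2 * ?s + 2) * tot y + 0 * y I1 \<le> (tot y)\<^sup>2" if "y \<in># Y" for y
        proof -
          have "tot y - ?s \<le> 0 \<or> 2 \<le> tot y - ?s"
            using parY[OF that] by presburger
          then have "0 \<le> (tot y - ?s) * (tot y - ?s - 2)"
            by (auto simp: zero_le_mult_iff)
          then show ?thesis using fact[of "tot y"] by linarith
        qed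
      qed
      then have "(tot x - ?s) * (tot x - ?s - 2) = 0"
        using fact[of "tot x"] by linarith
      then show ?thesis by auto
    qed
    with X show ?thesis
      by (intro cell_unique_tight[OF size sums spread, of "tot d"]) auto
  next
    case gap
    have sx: "x k \<le> x (nx k) + 1 \<and> x k \<le> x (nx (nx k)) + 1 \<and>
        x (nx k) \<le> x k + 1 \<and> x (nx k) \<le> x (nx (nx k)) + 1 \<and>
        x (nx (nx k)) \<le> x k + 1 \<and> x (nx (nx k)) \<le> x (nx k) + 1" if "x \<in># X" for x k
      using spreadX[OF that] unfolding spread_nx[of _ k] .
    have "stuck d e" using stuck d(1) e(1) gap by blast
    moreover have "tot d = 3 * m \<or> tot d = 3 * m + 1 \<or> tot d = 3 * m + 2"
      unfolding m_def by presburger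
    ultimately have "tot d = 3 * m + 1 \<and> (\<forall>i. e i = d i + 2) \<or> tot d = 3 * m + 2 \<and> (\<forall>i. e i = d i + 2) \<or>
        tot d = 3 * m + 1 \<and> tot e = tot d + 4 \<and> (\<forall>i. d i + 1 \<le> e i)"
      unfolding stuck_def by auto
    then consider (A) "tot d = 3 * m + 1" "\<forall>i. e i = d i + 2"
      | (C) "tot d = 3 * m + 2" "\<forall>i. e i = d i + 2"
      | (B) "tot d = 3 * m + 1" "tot e = tot d + 4" "\<forall>i. d i + 1 \<le> e i"
      by blast
    then show ?thesis
    proof cases
      case A
      obtain k where k: "d = vec k (m + 1) m m"
        using spread_cases1[OF spreadX[OF d(1)] A(1)]
        by (metis prod.inject eq_vec_iff nx.simps)
      have e6: "tot e = tot d + 6"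
        using A(2) by (simp add: tot_def)
      have X: "(tot x - 3 * m, x k - m) \<in> {(1, 1), (5, 2), (7, 3)}" if x: "x \<in># X" for x
      proof -
        have "tot x = tot d \<or> tot x = tot d + 2 \<or> tot x = tot d + 4 \<or> tot x = tot d + 6"
          using d(2)[OF x] e(2)[OF x] e6 parX[OF x] by presburger
        then show ?thesis
        proof (elim disjE)
          assume t: "tot x = tot d"
          then have "e k = x k + 2"
            using stuck[OF x e(1)] e6 unfolding stuck_def by auto
          then show ?thesis using t A k by simp
        next
          \<comment> \<open>This total is divisible by 3 and 4 below that of \<open>e\<close>, so
            the pair would not be stuck.\<close>
          assume t: "tot x = tot d + 2"
          then have "tot x mod 3 = 1 \<or> (\<forall>i. e i = x i + 2)"
            using stuck[OF x e(1)] e6 unfolding stuck_def by auto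
          moreover have "tot e = tot x + 6" if "\<forall>i. e i = x i + 2"
            using that by (simp add: tot_def)
          ultimately have "tot x mod 3 = 1 \<or> tot e = tot x + 6" by blast
          then have False using t A(1) e6 by presburger
          then show ?thesis ..
        next
          assume t: "tot x = tot d + 4"
          then have "d k + 1 \<le> x k"
            using stuck[OF d(1) x] unfolding stuck_def by auto
          then show ?thesis
            using t A(1) k sx[OF x, of k] tot_nx[of x k] by simp
        next
          assume t: "tot x = tot d + 6"
          then have "x k = d k + 2"
            using stuck[OF d(1) x] unfolding stuck_def by auto
          then show ?thesis using t A k by simp
        qed
      qed
      have "(tot y - 3 * m, y k - m) \<in> {(1, 1), (5, 2), (7, 3)}" if "y \<in># Y" for y
      proof (rule certificate_spread[OF size sums le _ spreadY, where a = "-23" and b = 0 and c = 24])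
        show "odd (tot x - 3 * m)" if "x \<in># Y" for x
          using parY[OF that] A(1) by presburger
        show "- 23 + 0 * (tot x - 3 * m) + 24 * (x k - m) = (tot x - 3 * m)\<^sup>2" if "x \<in># X" for x
          using X[OF that] by auto
      qed (use cert_A cert_A_eq that in \<open>simp_all add: algebra_simps\<close>)
      with X have "X = Y"
        by (intro cell_unique_A[OF size sums spread, of m k]) auto
      then show ?thesis ..
    next
      case C
      \<comment> \<open>Shifting by one gives \<open>d\<close> the translated total -1, as in
        \<open>cert_C\<close>.\<close>
      define n where "n = m + 1"
      have td: "tot d = 3 * n - 1"
        using C(1) by (simp add: n_def)
      obtain k where k: "d = vec k (n - 1) n n"
        using spread_cases2[OF spreadX[OF d(1)] C(1)] unfolding n_def
        by (metis prod.inject eq_vec_iff nx.simps add_diff_cancel_right')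
      have e6: "tot e = tot d + 6"
        using C(2) by (simp add: tot_def)
      have X: "(tot x - 3 * n, x k - n) \<in> {(-1, -1), (1, 0), (5, 1)}" if x: "x \<in># X" for x
      proof -
        have "tot x = tot d \<or> tot x = tot d + 2 \<or> tot x = tot d + 4 \<or> tot x = tot d + 6"
          using d(2)[OF x] e(2)[OF x] e6 parX[OF x] by presburger
        then show ?thesis
        proof (elim disjE)
          assume t: "tot x = tot d"
          then have "e k = x k + 2"
            using stuck[OF x e(1)] e6 unfolding stuck_def by auto
          then show ?thesis using t C(2) td k by simp
        next
          assume t: "tot x = tot d + 2"
          then have "x k + 1 \<le> e k"
            using stuck[OF x e(1)] e6 unfolding stuck_def by auto
          then show ?thesis
            using t td C(2) k sx[OF x, of k] tot_nx[of x k] by simp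
        next
          \<comment> \<open>A pair with totals 4 apart is stuck only if the lower total is 1 modulo
            3, but that of \<open>d\<close> is 2.\<close>
          assume t: "tot x = tot d + 4"
          have "tot d mod 3 = 1 \<or> (\<forall>i. x i = d i + 2)"
            using stuck[OF d(1) x] t unfolding stuck_def by auto
          moreover have "tot x = tot d + 6" if "\<forall>i. x i = d i + 2"
            using that by (simp add: tot_def)
          ultimately have "tot d mod 3 = 1 \<or> tot x = tot d + 6" by blast
          then have False using t C(1) by presburger
          then show ?thesis ..
        next
          assume t: "tot x = tot d + 6"
          then have "x k = d k + 2"
            using stuck[OF d(1) x] unfolding stuck_def by auto
          then show ?thesis using t td k by simp
        qed
      qed
      have "(tot y - 3 * n, y k - n) \<in> {(-1, -1), (1, 0), (5, 1)}" if "y \<in># Y" for y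
      proof (rule certificate_spread[OF size sums le _ spreadY, where a = "-11" and b = 12 and c = "-24"])
        show "odd (tot x - 3 * n)" if "x \<in># Y" for x
          using parY[OF that] td by presburger
        show "- 11 + 12 * (tot x - 3 * n) + - 24 * (x k - n) = (tot x - 3 * n)\<^sup>2" if "x \<in># X" for x
          using X[OF that] by auto
      qed (use cert_C cert_C_eq that in \<open>simp_all add: algebra_simps\<close>)
      with X have "X = Y"
        by (intro cell_unique_C[OF size sums spread, of n k]) auto
      then show ?thesis ..
    next
      case B
      obtain k where k: "d = vec k (m + 1) m m"
        using spread_cases1[OF spreadX[OF d(1)] B(1)]
        by (metis prod.inject eq_vec_iff nx.simps)
      \<comment> \<open>The total \<open>3 * m + 5\<close> leaves exactly one entry
        \<open>m + 1\<close> in \<open>e\<close>. It is not at \<open>k\<close>, where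
        \<open>d\<close> already has \<open>m + 1\<close>. Below, \<open>l\<close> is its position
        and \<open>l'\<close> the third coordinate.\<close>
      have "e (nx k) = m + 1 \<and> e k = m + 2 \<and> e (nx (nx k)) = m + 2 \<or>
          e (nx (nx k)) = m + 1 \<and> e k = m + 2 \<and> e (nx k) = m + 2"
        using B(1,2) B(3)[rule_format, of k] k sx[OF e(1), of k] tot_nx[of e k] by simp linarith
      then obtain l l' where l: "{l, l'} = {nx k, nx (nx k)}" "e l = m + 1" "e k = m + 2" "e l' = m + 2"
        by (metis insert_commute)
      have tot: "tot x = x k + x l + x l'" for x :: "idx \<Rightarrow> int"
        using l(1) tot_nx[of x k] by (auto simp: doubleton_eq_iff)
      have sx': "x k \<le> x l + 1 \<and> x k \<le> x l' + 1 \<and> x l \<le> x k + 1 \<and> x l \<le> x l' + 1 \<and>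
          x l' \<le> x k + 1 \<and> x l' \<le> x l + 1" if "x \<in># X" for x
        using l(1) sx[OF that, of k] by (auto simp: doubleton_eq_iff)
      have X: "tot x = tot d \<and> x l = m \<or> tot x = tot d + 2 \<or> tot x = tot d + 4 \<and> x k = m + 2" if x: "x \<in># X" for x
      proof -
        have "tot x = tot d \<or> tot x = tot d + 2 \<or> tot x = tot d + 4"
          using d(2)[OF x] e(2)[OF x] B(2) parX[OF x] by presburger
        moreover have "x l = m" if t: "tot x = tot d"
        proof -
          have "(\<forall>i. e i = x i + 2) \<or> x l + 1 \<le> e l"
            using stuck[OF x e(1)] t B(2) unfolding stuck_def by auto
          then show ?thesis
            using t B(1,2) l(2) sx'[OF x] tot[of x] by auto
        qed
        moreover have "x k = m + 2" if t: "tot x = tot d + 4"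
        proof -
          have "d k + 1 \<le> x k"
            using stuck[OF d(1) x] t unfolding stuck_def by auto
          then show ?thesis
            using t B(1) k sx'[OF x] tot[of x] by simp
        qed
        ultimately show ?thesis by blast
      qed
      show ?thesis
      \<comment> \<open>The remaining choice: either \<open>e\<close> is the only vector of maximal
        total, or another one, low at \<open>l'\<close>, also occurs. In the second case both
        together force every vector of minimal total to equal \<open>d\<close>.\<close>
      proof (cases "\<forall>x\<in>#X. tot x = tot d + 4 \<longrightarrow> x l = m + 1")
        case True
        have X': "(tot x - 3 * m, x l - m) \<in> {(1, 0), (3, 1), (5, 1)}" if x: "x \<in># X" for x
          using X[OF x] True[rule_format, OF x] B(1) sx'[OF x] tot[of x] by auto
        have "(tot y - 3 * m, y l - m) \<in> {(1, 0), (3, 1), (5, 1)}" if "y \<in># Y" for y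
        proof (rule certificate_spread[OF size sums le _ spreadY, where a = "-7" and b = 8 and c = "-8"])
          show "odd (tot x - 3 * m)" if "x \<in># Y" for x
            using parY[OF that] B(1) by presburger
          show "- 7 + 8 * (tot x - 3 * m) + - 8 * (x l - m) = (tot x - 3 * m)\<^sup>2" if "x \<in># X" for x
            using X'[OF that] by auto
        qed (use cert_B1 cert_B1_eq that in \<open>simp_all add: algebra_simps\<close>)
        with X' have "X = Y"
          by (intro cell_unique_B1[OF size sums spread, of m l]) auto
        then show ?thesis ..
      next
        case False
        then obtain z where z: "z \<in># X" "tot z = tot d + 4" "z l \<noteq> m + 1"
          by blast
        have zv: "z l = m + 2" "z l' = m + 1"
          using X[OF z(1)] z(2,3) B(1) sx'[OF z(1)] tot[of z] by auto
        have X': "(tot x - 3 * m, x k - m) \<in> {(1, 1), (3, 1), (5, 2)}" if x: "x \<in># X" for x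
        proof -
          have "x l' = m" if t: "tot x = tot d"
          proof -
            have "(\<forall>i. z i = x i + 2) \<or> x l' + 1 \<le> z l'"
              using stuck[OF x z(1)] t z(2) unfolding stuck_def by auto
            then show ?thesis
              using t B(1) z(2) zv sx'[OF x] tot[of x] tot[of z] by auto
          qed
          then show ?thesis
            using X[OF x] B(1) sx'[OF x] tot[of x] by auto
        qed
        have "(tot y - 3 * m, y k - m) \<in> {(1, 1), (3, 1), (5, 2)}" if "y \<in># Y" for y
        proof (rule certificate_spread[OF size sums le _ spreadY, where a = "-11" and b = 4 and c = 8])
          show "odd (tot x - 3 * m)" if "x \<in># Y" for x
            using parY[OF that] B(1) by presburger
          show "- 11 + 4 * (tot x - 3 * m) + 8 * (x k - m) = (tot x - 3 * m)\<^sup>2" if "x \<in># X" for x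
            using X'[OF that] by auto
        qed (use cert_B2 cert_B2_eq that in \<open>simp_all add: algebra_simps\<close>)
        with X' have "X = Y"
          by (intro cell_unique_B2[OF size sums spread, of m k]) auto
        then show ?thesis ..
      qed
    qed
  qed
qed

section \<open>Quadratic moves between multisets of words\<close>

definition ssum :: "('a \<Rightarrow> idx \<Rightarrow> int) \<Rightarrow> 'a multiset \<Rightarrow> idx \<Rightarrow> int" where
  "ssum f X i = (\<Sum>w\<in>#X. f w i)"

lemma ssum_simps [simp]:
  "ssum f {#} i = 0"
  "ssum f (add_mset x X) i = f x i + ssum f X i"
  "ssum f (X + Y) i = ssum f X i + ssum f Y i"
  by (simp_all add: ssum_def)

text \<open>Equality of the sufficient statistics in terms of sums and differences along edges; see
  \<open>same_stat_iff\<close>.\<close>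

definition same_stat :: "nat list multiset \<Rightarrow> nat list multiset \<Rightarrow> bool" where
  "same_stat X Y \<longleftrightarrow> size X = size Y \<and> (\<forall>i. ssum dv X i = ssum dv Y i) \<and> (\<forall>i. ssum sv X i = ssum sv Y i)"

text \<open>Size 1 covers the exchange of two words with identical counts. Since
  \<open>same_stat\<close> preserves the size, \<open>L\<close> is as small as
  \<open>K\<close>.\<close>

definition step :: "nat \<Rightarrow> nat list multiset \<Rightarrow> nat list multiset \<Rightarrow> bool" where
  "step T X Y \<longleftrightarrow> (\<exists>K L M. X = K + M \<and> Y = L + M \<and> size K \<le> 2 \<and>
     set_mset K \<subseteq> Omega T \<and> set_mset L \<subseteq> Omega T \<and> same_stat K L)"

abbreviation conn :: "nat \<Rightarrow> nat list multiset \<Rightarrow> nat list multiset \<Rightarrow> bool" where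
  "conn T \<equiv> (step T)\<^sup>*\<^sup>*"

lemma step_sym:
  assumes "step T X Y"
  shows "step T Y X"
proof -
  obtain K L M where "X = K + M" "Y = L + M" "size K \<le> 2" "set_mset K \<subseteq> Omega T" "set_mset L \<subseteq> Omega T"
    "same_stat K L"
    using assms unfolding step_def by blast
  then show ?thesis
    unfolding step_def by (intro exI[of _ L] exI[of _ K] exI[of _ M]) (auto simp: same_stat_def)
qed

lemma step_add:
  assumes "step T X Y"
  shows "step T (X + N) (Y + N)"
proof -
  obtain K L M where "X = K + M" "Y = L + M" "size K \<le> 2" "set_mset K \<subseteq> Omega T" "set_mset L \<subseteq> Omega T"
    "same_stat K L"
    using assms unfolding step_def by blast
  then show ?thesis
    unfolding step_def by (intro exI[of _ K] exI[of _ L] exI[of _ "M + N"]) (auto simp: add.assoc)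
qed

lemma conn_sym: "conn T X Y \<Longrightarrow> conn T Y X"
  by (induction rule: rtranclp_induct) (auto dest: step_sym intro: converse_rtranclp_into_rtranclp)

lemma conn_add: "conn T X Y \<Longrightarrow> conn T (X + M) (Y + M)"
  by (induction rule: rtranclp_induct) (auto dest: step_add intro: rtranclp.rtrancl_into_rtrancl)

lemma conn_invariant:
  assumes "conn T X Y" "set_mset X \<subseteq> Omega T"
  shows "set_mset Y \<subseteq> Omega T \<and> same_stat X Y"
  using assms
proof (induction rule: rtranclp_induct)
  case (step Y Z)
  then have Y: "set_mset Y \<subseteq> Omega T" "same_stat X Y" by auto
  obtain K L M where "Y = K + M" "Z = L + M" "set_mset L \<subseteq> Omega T" "same_stat K L"
    using step.hyps(2) unfolding step_def by blast
  then show ?case using Y by (auto simp: same_stat_def)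
qed (simp add: same_stat_def)

lemma conn_single:
  assumes "x \<in> Omega T" "y \<in> Omega T" "dv x = dv y" "sv x = sv y"
  shows "conn T (add_mset x M) (add_mset y M)"
proof -
  have "step T (add_mset x M) (add_mset y M)"
    unfolding step_def using assms
    by (intro exI[of _ "{#x#}"] exI[of _ "{#y#}"] exI[of _ M]) (auto simp: same_stat_def)
  then show ?thesis ..
qed

lemma conn_pair:
  assumes "x \<in> Omega T" "y \<in> Omega T" "x' \<in> Omega T" "y' \<in> Omega T"
    and "\<And>i. dv x i + dv y i = dv x' i + dv y' i" "\<And>i. sv x i + sv y i = sv x' i + sv y' i"
  shows "conn T (add_mset x (add_mset y M)) (add_mset x' (add_mset y' M))"
proof -
  have "step T (add_mset x (add_mset y M)) (add_mset x' (add_mset y' M))"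
    unfolding step_def using assms
    by (intro exI[of _ "{#x, y#}"] exI[of _ "{#x', y'#}"] exI[of _ M]) (auto simp: same_stat_def)
  then show ?thesis ..
qed

section \<open>Changing the difference vectors of two words\<close>

lemma Omega_parity:
  assumes "w \<in> Omega T"
  shows "even (tot (dv w) - int (T - 1))"
  using Omega_tot[OF assms] even_dv_sv[of w I1] even_dv_sv[of w I2] even_dv_sv[of w I3]
  unfolding tot_def by presburger

lemma Omega_abs:
  assumes "w \<in> Omega T"
  shows "\<bar>tot (dv w)\<bar> \<le> int (T - 1)"
  using Omega_tot[OF assms] dv_le_sv[of w I1] dv_le_sv[of w I2] dv_le_sv[of w I3]
  unfolding tot_def by linarith

text \<open>Entries that differ by at most 1 never have strictly opposite signs.\<close>

lemma spread_abs_tot: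
  assumes "spread d"
  shows "tot (\<lambda>i. \<bar>d i\<bar>) = \<bar>tot d\<bar>"
  using assms unfolding spread_nx[of _ I1] tot_nx[of _ I1] by linarith

text \<open>The coordinates are filled greedily, one after the other.\<close>

lemma bounded_with_tot:
  fixes g :: "idx \<Rightarrow> int"
  assumes "\<And>i. 0 \<le> g i" "0 \<le> c" "c \<le> tot g"
  shows "\<exists>a. (\<forall>i. 0 \<le> a i) \<and> (\<forall>i. a i \<le> g i) \<and> tot a = c"
proof -
  have g: "0 \<le> g I1" "0 \<le> g I2" "0 \<le> g I3" using assms(1) by auto
  consider "c \<le> g I1" | "g I1 < c" "c \<le> g I1 + g I2" | "g I1 + g I2 < c"
    by linarith
  then show ?thesis
  proof cases
    case 1
    then show ?thesis using assms(2,3) g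
      by (intro exI[of _ "vec I1 c 0 0"]) (simp add: all_idx tot_def vec_def)
  next
    case 2
    then show ?thesis using assms(2,3) g
      by (intro exI[of _ "vec I1 (g I1) (c - g I1) 0"]) (simp add: all_idx tot_def vec_def)
  next
    case 3
    then show ?thesis using assms(2,3) g
      by (intro exI[of _ "vec I1 (g I1) (g I2) (c - g I1 - g I2)"]) (simp add: all_idx tot_def vec_def)
  qed
qed

text \<open>On each edge a word must make \<open>\<bar>d i\<bar>\<close> transitions, and all others
  come in back-and-forth pairs. Once the forced transitions of \<open>d\<close> and \<open>e\<close>
  fit into the joint supply of \<open>p\<close> and \<open>q\<close>, the surplus pairs can be
  shared out to give both words the right length.\<close>

lemma pair_replace:
  assumes "p \<in> Omega T" "q \<in> Omega T" "T \<ge> 2" "spread d" "spread e"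
    and sum: "\<And>i. d i + e i = dv p i + dv q i"
    and le: "\<And>i. \<bar>d i\<bar> + \<bar>e i\<bar> \<le> sv p i + sv q i"
    and "\<bar>tot d\<bar> \<le> int (T - 1)" "\<bar>tot e\<bar> \<le> int (T - 1)" "even (tot d - int (T - 1))"
  obtains p' q' where "p' \<in> Omega T" "q' \<in> Omega T" "dv p' = d" "dv q' = e"
    "\<And>i. sv p' i + sv q' i = sv p i + sv q i"
proof -
  define n where "n = int (T - 1)"
  define g where "g i = (sv p i + sv q i - \<bar>d i\<bar> - \<bar>e i\<bar>) div 2" for i
  have g2: "2 * g i = sv p i + sv q i - \<bar>d i\<bar> - \<bar>e i\<bar>" for i
  proof -
    have "even (sv p i + sv q i - \<bar>d i\<bar> - \<bar>e i\<bar>)"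
      using sum[of i] even_dv_sv[of p i] even_dv_sv[of q i] by presburger
    then show ?thesis unfolding g_def by presburger
  qed
  have g0: "0 \<le> g i" for i using g2[of i] le[of i] by linarith
  define c where "c = (n - \<bar>tot d\<bar>) div 2"
  have c2: "2 * c = n - \<bar>tot d\<bar>"
    using assms(10) unfolding c_def n_def by presburger
  have c0: "0 \<le> c" using c2 assms(8) unfolding n_def by linarith
  have "2 * tot g = tot (sv p) + tot (sv q) - tot (\<lambda>i. \<bar>d i\<bar>) - tot (\<lambda>i. \<bar>e i\<bar>)"
    by (simp add: tot_def distrib_left g2)
  then have "2 * tot g = 2 * n - \<bar>tot d\<bar> - \<bar>tot e\<bar>"
    by (simp add: Omega_tot[OF assms(1)] Omega_tot[OF assms(2)] spread_abs_tot assms(4,5) n_def)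
  then have cg: "c \<le> tot g"
    using c2 assms(9) unfolding n_def by linarith
  obtain a where a: "\<And>i. 0 \<le> a i" "\<And>i. a i \<le> g i" and ta: "tot a = c"
    using bounded_with_tot[of g c] g0 c0 cg by blast
  define s where "s i = \<bar>d i\<bar> + 2 * a i" for i
  define s' where "s' i = sv p i + sv q i - s i" for i
  have s'_alt: "s' i = \<bar>e i\<bar> + 2 * (g i - a i)" for i
    using g2[of i] by (simp add: s'_def s_def algebra_simps)
  have ts: "tot s = n"
  proof -
    have "tot s = tot (\<lambda>i. \<bar>d i\<bar>) + 2 * tot a"
      by (simp add: tot_def s_def)
    then show ?thesis using ta c2 spread_abs_tot[OF assms(4)] by simp
  qed
  have ts': "tot s' = n"
  proof -
    have "tot s' = tot (sv p) + tot (sv q) - tot s"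
      by (simp add: tot_def s'_def)
    then show ?thesis using ts Omega_tot[OF assms(1)] Omega_tot[OF assms(2)] by (simp add: n_def)
  qed
  obtain p' where p': "p' \<in> Omega T" "dv p' = d" "sv p' = s"
  proof (rule word_exists[of d s T])
    show "\<bar>d i\<bar> \<le> s i" for i
      using a(1)[of i] by (simp add: s_def)
    show "even (s i - d i)" for i
      unfolding s_def by presburger
  qed (use assms ts in \<open>auto simp: n_def\<close>)
  obtain q' where q': "q' \<in> Omega T" "dv q' = e" "sv q' = s'"
  proof (rule word_exists[of e s' T])
    show "\<bar>e i\<bar> \<le> s' i" for i
      using a(2)[of i] by (simp add: s'_alt)
    show "even (s' i - e i)" for i
      unfolding s'_alt by presburger
  qed (use assms ts' in \<open>auto simp: n_def\<close>)
  show thesis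
    by (rule that[OF p'(1) q'(1) p'(2) q'(2)]) (simp add: p' q' s'_def)
qed

text \<open>Descent on the sum of the squared totals: each rebalancing is realised by a quadratic
  move and lowers it.\<close>

lemma conn_stable:
  assumes "set_mset X \<subseteq> Omega T" "T \<ge> 2"
  shows "\<exists>X'. conn T X X' \<and> stable (image_mset dv X')"
  using assms(1)
proof (induction "nat (\<Sum>w\<in>#X. (tot (dv w))\<^sup>2)" arbitrary: X rule: less_induct)
  case less
  show ?case
  proof (cases "stable (image_mset dv X)")
    case True
    then show ?thesis by blast
  next
    case False
    then obtain p q where pq: "p \<in># X" "q \<in># X" "tot (dv p) + 4 \<le> tot (dv q)" "\<not> stuck (dv p) (dv q)"
      unfolding stable_def by auto
    have \<Omega>: "p \<in> Omega T" "q \<in> Omega T" using pq less.prems by auto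
    have sp: "spread (dv p)" "spread (dv q)" using Omega_spread \<Omega> assms(2) by auto
    obtain M where X: "X = add_mset p (add_mset q M)"
    proof -
      have "q \<in># X - {#p#}" using pq by (auto simp: in_diff_count)
      then show thesis using pq(1) that by (metis insert_DiffM)
    qed
    have ev: "even (tot (dv q) - tot (dv p))"
      using Omega_parity[OF \<Omega>(1)] Omega_parity[OF \<Omega>(2)] by presburger
    obtain v where v: "spread (\<lambda>i. dv p i + v i)" "spread (\<lambda>i. dv q i - v i)"
      "\<And>i. 0 \<le> v i" "\<And>i. v i \<le> dv q i - dv p i" "0 < tot v" "tot v < tot (dv q) - tot (dv p)" "even (tot v)"
      using rebalance[OF sp ev pq(3,4)] by blast
    let ?d = "\<lambda>i. dv p i + v i" and ?e = "\<lambda>i. dv q i - v i"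
    have tot: "tot ?d = tot (dv p) + tot v" "tot ?e = tot (dv q) - tot v"
      by (simp_all add: tot_def)
    obtain p' q' where p'q': "p' \<in> Omega T" "q' \<in> Omega T" "dv p' = ?d" "dv q' = ?e"
      "\<And>i. sv p' i + sv q' i = sv p i + sv q i"
    proof (rule pair_replace[OF \<Omega> assms(2) v(1,2)])
      show "\<bar>?d i\<bar> + \<bar>?e i\<bar> \<le> sv p i + sv q i" for i
        using v(3)[of i] v(4)[of i] dv_le_sv[of p i] dv_le_sv[of q i] by linarith
      show "\<bar>tot ?d\<bar> \<le> int (T - 1)" "\<bar>tot ?e\<bar> \<le> int (T - 1)"
        using v(5,6) Omega_abs[OF \<Omega>(1)] Omega_abs[OF \<Omega>(2)] unfolding tot by linarith+
      show "even (tot ?d - int (T - 1))"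
        using Omega_parity[OF \<Omega>(1)] v(7) unfolding tot by presburger
    qed simp_all
    let ?X = "add_mset p' (add_mset q' M)"
    have conn: "conn T X ?X"
      unfolding X using p'q' \<Omega> by (intro conn_pair) auto
    have sq: "(t + s)\<^sup>2 + (u - s)\<^sup>2 < t\<^sup>2 + u\<^sup>2" if "0 < s" "s < u - t" for s t u :: int
    proof -
      have "0 < s * (u - t - s)" using that by (intro mult_pos_pos) auto
      then show ?thesis by (simp add: power2_eq_square algebra_simps)
    qed
    have nn: "0 \<le> (\<Sum>w\<in>#M. (tot (dv w))\<^sup>2)"
      by (induction M) auto
    have "nat (\<Sum>w\<in>#?X. (tot (dv w))\<^sup>2) < nat (\<Sum>w\<in>#X. (tot (dv w))\<^sup>2)"
    proof -
      have "0 < (tot (dv p))\<^sup>2 + (tot (dv q))\<^sup>2"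
        using sq[OF v(5,6)] by (rule le_less_trans[rotated]) simp
      with sq[OF v(5,6)] nn show ?thesis
        unfolding X by (simp add: p'q' tot)
    qed
    moreover have "set_mset ?X \<subseteq> Omega T"
      using conn_invariant[OF conn less.prems] by blast
    ultimately obtain X' where "conn T ?X X'" "stable (image_mset dv X')"
      using less.hyps by blast
    then show ?thesis using conn by (meson rtranclp_trans)
  qed
qed

section \<open>Contingency tables for fixed difference vectors\<close>

lemma slack_ge_2:
  assumes "\<bar>dv w i\<bar> < sv w i"
  shows "\<bar>dv w i\<bar> + 2 \<le> sv w i"
  using assms even_dv_sv[of w i] by presburger

text \<open>The basic move of a two-way table whose rows are words and whose columns are edges:
  \<open>x\<close> gives a back-and-forth pair on \<open>g\<close> to \<open>z\<close> and receives
  one on \<open>h\<close>.\<close>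

lemma conn_exchange:
  assumes "x \<in> Omega T" "z \<in> Omega T" "T \<ge> 2" "g \<noteq> h"
    and g: "\<bar>dv x g\<bar> + 2 \<le> sv x g" and h: "\<bar>dv z h\<bar> + 2 \<le> sv z h"
  obtains x' z' where "x' \<in> Omega T" "z' \<in> Omega T" "dv x' = dv x" "dv z' = dv z"
    "sv x' = (sv x)(g := sv x g - 2, h := sv x h + 2)" "\<And>i. sv x' i + sv z' i = sv x i + sv z i"
    "\<And>M. conn T (add_mset x (add_mset z M)) (add_mset x' (add_mset z' M))"
proof -
  let ?s = "(sv x)(g := sv x g - 2, h := sv x h + 2)" and ?s' = "(sv z)(g := sv z g + 2, h := sv z h - 2)"
  have sp: "spread (dv x)" "spread (dv z)"
    using Omega_spread assms(1-3) by auto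
  obtain x' where x': "x' \<in> Omega T" "dv x' = dv x" "sv x' = ?s"
  proof (rule word_exists[OF sp(1), of ?s T])
    show "\<bar>dv x i\<bar> \<le> ?s i" for i
      using g dv_le_sv[of x i] by auto
    show "even (?s i - dv x i)" for i
      using even_dv_sv[of x i] by auto
    show "tot ?s = int (T - 1)"
      using Omega_tot[OF assms(1)] assms(4) by (cases g; cases h) (auto simp: tot_def)
  qed (use assms in auto)
  obtain z' where z': "z' \<in> Omega T" "dv z' = dv z" "sv z' = ?s'"
  proof (rule word_exists[OF sp(2), of ?s' T])
    show "\<bar>dv z i\<bar> \<le> ?s' i" for i
      using h dv_le_sv[of z i] by auto
    show "even (?s' i - dv z i)" for i
      using even_dv_sv[of z i] by auto
    show "tot ?s' = int (T - 1)"
      using Omega_tot[OF assms(2)] assms(4) by (cases g; cases h) (auto simp: tot_def)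
  qed (use assms in auto)
  have sum: "sv x' i + sv z' i = sv x i + sv z i" for i
    using assms(4) by (auto simp: x' z')
  have "conn T (add_mset x (add_mset z M)) (add_mset x' (add_mset z' M))" for M
    using assms x' z' sum by (intro conn_pair) auto
  then show thesis
    using that[OF x'(1) z'(1) x'(2) z'(2) x'(3) sum] by blast
qed

text \<open>Exchanges bring \<open>sv x\<close> to \<open>sv y\<close> unit by unit. The last
  hypothesis says that the other words keep their forced transitions when \<open>sv y\<close> is
  taken out of the supply, and exchanges preserve it.\<close>

lemma conn_realign:
  assumes "set_mset (add_mset x M) \<subseteq> Omega T" "y \<in> Omega T" "T \<ge> 2" "dv y = dv x"
    and "\<And>i. sv y i + ssum (\<lambda>w i. \<bar>dv w i\<bar>) M i \<le> sv x i + ssum sv M i"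
  shows "\<exists>M'. conn T (add_mset x M) (add_mset y M') \<and> image_mset dv M' = image_mset dv M"
  using assms
proof (induction "nat (tot (\<lambda>i. \<bar>sv x i - sv y i\<bar>))" arbitrary: x M rule: less_induct)
  case less
  have x: "x \<in> Omega T" using less.prems(1) by simp
  show ?case
  proof (cases "sv x = sv y")
    case True
    then have "conn T (add_mset x M) (add_mset y M)"
      using less.prems x by (intro conn_single) auto
    then show ?thesis by blast
  next
    case False
    have tots: "tot (sv x) = tot (sv y)"
      using Omega_tot[OF x] Omega_tot[OF less.prems(2)] by simp
    have "\<exists>g. sv y g < sv x g" "\<exists>h. sv x h < sv y h"
      using False tots unfolding fun_eq_iff all_idx ex_idx tot_def by linarith+
    then obtain g h where gh: "sv y g < sv x g" "sv x h < sv y h" by blast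
    have par: "even (sv x i - sv y i)" for i
      using even_dv_sv[of x i] even_dv_sv[of y i] unfolding less.prems(4) by presburger
    have gh2: "sv y g + 2 \<le> sv x g" "sv x h + 2 \<le> sv y h"
      using gh par[of g] par[of h] by presburger+
    \<comment> \<open>If no other word had a spare pair on \<open>h\<close>, the last hypothesis at
      \<open>h\<close> would give \<open>sv y h \<le> sv x h\<close>.\<close>
    have "\<exists>z\<in>#M. \<bar>dv z h\<bar> < sv z h"
    proof (rule ccontr)
      assume "\<not> ?thesis"
      then have "ssum sv M h \<le> ssum (\<lambda>w i. \<bar>dv w i\<bar>) M h"
        unfolding ssum_def by (intro sum_mset_mono) auto
      then show False using less.prems(5)[of h] gh by simp
    qed
    then obtain z where z: "z \<in># M" "\<bar>dv z h\<bar> + 2 \<le> sv z h"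
      using slack_ge_2 by blast
    then obtain N where M: "M = add_mset z N"
      by (metis insert_DiffM)
    have "\<bar>dv x g\<bar> + 2 \<le> sv x g"
      using gh2(1) dv_le_sv[of y g] less.prems(4) by simp
    moreover have "z \<in> Omega T" "g \<noteq> h"
      using z(1) less.prems(1) gh by auto
    ultimately obtain x' z' where x'z': "x' \<in> Omega T" "z' \<in> Omega T" "dv x' = dv x" "dv z' = dv z"
      "sv x' = (sv x)(g := sv x g - 2, h := sv x h + 2)" "\<And>i. sv x' i + sv z' i = sv x i + sv z i"
      "\<And>N. conn T (add_mset x (add_mset z N)) (add_mset x' (add_mset z' N))"
      using conn_exchange[OF x _ less.prems(3) _ _ z(2)] by blast
    let ?M = "add_mset z' N"
    have "\<bar>sv x' i - sv y i\<bar> \<le> \<bar>sv x i - sv y i\<bar>" "\<bar>sv x' g - sv y g\<bar> < \<bar>sv x g - sv y g\<bar>" for i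
      using gh2 \<open>g \<noteq> h\<close> by (auto simp: x'z'(5))
    then have "tot (\<lambda>i. \<bar>sv x' i - sv y i\<bar>) < tot (\<lambda>i. \<bar>sv x i - sv y i\<bar>)"
      unfolding tot_nx[of _ g] by (meson add_less_le_mono)
    moreover have "0 \<le> tot (\<lambda>i. \<bar>sv x' i - sv y i\<bar>)"
      by (simp add: tot_def)
    ultimately have "nat (tot (\<lambda>i. \<bar>sv x' i - sv y i\<bar>)) < nat (tot (\<lambda>i. \<bar>sv x i - sv y i\<bar>))"
      by linarith
    moreover have "set_mset (add_mset x' ?M) \<subseteq> Omega T"
      using less.prems(1) M x'z' by auto
    moreover have "sv y i + ssum (\<lambda>w i. \<bar>dv w i\<bar>) ?M i \<le> sv x' i + ssum sv ?M i" for i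
      using less.prems(5)[of i] x'z'(6)[of i] M x'z'(4) by simp
    ultimately obtain M' where "conn T (add_mset x' ?M) (add_mset y M')" "image_mset dv M' = image_mset dv ?M"
      using less.hyps[of x' ?M] less.prems x'z'(3) by auto
    then show ?thesis
      using x'z'(4) x'z'(7)[of N] unfolding M by (intro exI[of _ M']) auto
  qed
qed

lemma ssum_image: "image_mset dv X = image_mset dv Y \<Longrightarrow> ssum (\<lambda>w i. f (dv w i)) X i = ssum (\<lambda>w i. f (dv w i)) Y i"
proof -
  assume "image_mset dv X = image_mset dv Y"
  then have "image_mset (\<lambda>d. f (d i)) (image_mset dv X) = image_mset (\<lambda>d. f (d i)) (image_mset dv Y)"
    by simp
  then show ?thesis by (simp add: ssum_def image_mset.compositionality comp_def)
qed

text \<open>The words of \<open>Y\<close> are produced one at a time. The supply suffices because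
  the rest of \<open>Y\<close>, with the same difference vectors, fits into it.\<close>

lemma conn_same_dv:
  assumes "set_mset X \<subseteq> Omega T" "set_mset Y \<subseteq> Omega T" "T \<ge> 2"
    and "image_mset dv X = image_mset dv Y" "\<And>i. ssum sv X i = ssum sv Y i"
  shows "conn T X Y"
  using assms
proof (induction Y arbitrary: X)
  case empty
  then show ?case by simp
next
  case (add y Y)
  obtain x where x: "x \<in># X" "dv x = dv y"
  proof -
    have "dv y \<in># image_mset dv X" using add.prems(4) by simp
    then show thesis using that by auto
  qed
  then obtain M where X: "X = add_mset x M" by (metis insert_DiffM)
  have img: "image_mset dv M = image_mset dv Y"
    using add.prems(4) x(2) unfolding X by simp
  have "sv y i + ssum (\<lambda>w i. \<bar>dv w i\<bar>) M i \<le> sv x i + ssum sv M i" for i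
  proof -
    have "ssum (\<lambda>w i. \<bar>dv w i\<bar>) M i = ssum (\<lambda>w i. \<bar>dv w i\<bar>) Y i"
      by (rule ssum_image[OF img])
    also have "\<dots> \<le> ssum sv Y i"
      unfolding ssum_def by (intro sum_mset_mono dv_le_sv)
    finally show ?thesis using add.prems(5)[of i] unfolding X by simp
  qed
  then obtain M' where M': "conn T X (add_mset y M')" "image_mset dv M' = image_mset dv M"
    using conn_realign[of x M T y] add.prems x(2) unfolding X by auto
  have inv: "set_mset (add_mset y M') \<subseteq> Omega T" "same_stat X (add_mset y M')"
    using conn_invariant[OF M'(1) add.prems(1)] by auto
  have "conn T M' Y"
    using inv add.prems(2,3,5) M'(2) img by (intro add.IH) (auto simp: same_stat_def)
  then have "conn T (add_mset y M') (add_mset y Y)"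
    using conn_add[of T M' Y "{#y#}"] by simp
  then show ?case using M'(1) by simp
qed

section \<open>Exchanging diagonals of an octahedron\<close>

lemma octa_eq_iff:
  assumes "c \<noteq> 0"
  shows "octa \<mu> c i = octa \<mu> c' j \<longleftrightarrow> i = j \<and> c = c'"
proof
  assume "octa \<mu> c i = octa \<mu> c' j"
  from fun_cong[OF this, of i] show "i = j \<and> c = c'"
    using assms by (auto simp: octa_def split: if_splits)
qed auto

text \<open>Size and sum fix the difference of the counts of opposite vertices in each direction. So
  two such multisets can differ only in the directions of their diagonals, that is, pairs of
  opposite vertices.\<close>

lemma octa_counts:
  assumes "\<forall>x\<in>#P. \<exists>i. x = octa \<mu> 1 i \<or> x = octa \<mu> (-1) i"
  shows "int (size P) = tot (\<lambda>i. int (count P (octa \<mu> 1 i)) + int (count P (octa \<mu> (-1) i)))"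
    and "(\<Sum>x\<in>#P. x i) = \<mu> * int (size P) + int (count P (octa \<mu> 1 i)) - int (count P (octa \<mu> (-1) i))"
    and "\<mu> = 0 \<Longrightarrow> (\<Sum>x\<in>#P. \<bar>x i\<bar>) = int (count P (octa \<mu> 1 i)) + int (count P (octa \<mu> (-1) i))"
proof -
  have "int (size P) = tot (\<lambda>i. int (count P (octa \<mu> 1 i)) + int (count P (octa \<mu> (-1) i))) \<and>
    (\<Sum>x\<in>#P. x i) = \<mu> * int (size P) + int (count P (octa \<mu> 1 i)) - int (count P (octa \<mu> (-1) i)) \<and>
    (\<mu> = 0 \<longrightarrow> (\<Sum>x\<in>#P. \<bar>x i\<bar>) = int (count P (octa \<mu> 1 i)) + int (count P (octa \<mu> (-1) i)))"
    using assms
  proof (induction P)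
    case (add x P)
    then obtain k s where k: "x = octa \<mu> s k" "s = 1 \<or> s = -1" by auto
    have c: "int (count (add_mset x P) (octa \<mu> 1 j)) = int (count P (octa \<mu> 1 j)) + of_bool (s = 1 \<and> j = k)"
      "int (count (add_mset x P) (octa \<mu> (-1) j)) = int (count P (octa \<mu> (-1) j)) + of_bool (s = -1 \<and> j = k)" for j
      using k by (auto simp: octa_eq_iff)
    have x: "x i = \<mu> + of_bool (s = 1 \<and> i = k) - of_bool (s = -1 \<and> i = k)"
      "\<mu> = 0 \<Longrightarrow> \<bar>x i\<bar> = of_bool (s = 1 \<and> i = k) + of_bool (s = -1 \<and> i = k)"
      using k by (auto simp: octa_def)
    have t: "tot (\<lambda>j. a j + of_bool (s = 1 \<and> j = k) + (b j + of_bool (s = -1 \<and> j = k))) = tot (\<lambda>j. a j + b j) + 1"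
      for a b :: "idx \<Rightarrow> int"
      using k(2) by (cases k) (auto simp: tot_def)
    have IH: "int (size P) = tot (\<lambda>i. int (count P (octa \<mu> 1 i)) + int (count P (octa \<mu> (-1) i)))"
      "(\<Sum>x\<in>#P. x i) = \<mu> * int (size P) + int (count P (octa \<mu> 1 i)) - int (count P (octa \<mu> (-1) i))"
      "\<mu> = 0 \<Longrightarrow> (\<Sum>x\<in>#P. \<bar>x i\<bar>) = int (count P (octa \<mu> 1 i)) + int (count P (octa \<mu> (-1) i))"
      using add by simp_all
    show ?case
    proof (intro conjI impI)
      show "int (size (add_mset x P)) = tot (\<lambda>i. int (count (add_mset x P) (octa \<mu> 1 i)) + int (count (add_mset x P) (octa \<mu> (-1) i)))"
        unfolding c t using IH(1) by simp
      show "(\<Sum>x\<in>#add_mset x P. x i) = \<mu> * int (size (add_mset x P)) +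
          int (count (add_mset x P) (octa \<mu> 1 i)) - int (count (add_mset x P) (octa \<mu> (-1) i))"
        unfolding c using IH(2) by (simp add: x algebra_simps)
      assume "\<mu> = 0"
      then show "(\<Sum>x\<in>#add_mset x P. \<bar>x i\<bar>) =
          int (count (add_mset x P) (octa \<mu> 1 i)) + int (count (add_mset x P) (octa \<mu> (-1) i))"
        unfolding c using IH(3) x(2) by simp
    qed
  qed (auto simp: tot_def)
  then show "int (size P) = tot (\<lambda>i. int (count P (octa \<mu> 1 i)) + int (count P (octa \<mu> (-1) i)))"
    and "(\<Sum>x\<in>#P. x i) = \<mu> * int (size P) + int (count P (octa \<mu> 1 i)) - int (count P (octa \<mu> (-1) i))"
    and "\<mu> = 0 \<Longrightarrow> (\<Sum>x\<in>#P. \<bar>x i\<bar>) = int (count P (octa \<mu> 1 i)) + int (count P (octa \<mu> (-1) i))"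
    by auto
qed

lemma spread_octa: "spread (octa \<mu> 1 i)" "spread (octa \<mu> (-1) i)"
  unfolding spread_def octa_def by auto

lemma tot_octa: "tot (octa \<mu> c i) = 3 * \<mu> + c"
  by (cases i) (auto simp: tot_def octa_def)

text \<open>Exchanging the diagonals of the octahedron centred at the origin increases a coordinate of the sum
  of the \<open>\<bar>d\<bar>\<close>, so one of the two words involved has to provide slack there.\<close>
lemma conn_make_room:
  assumes "set_mset (add_mset x M) \<subseteq> Omega T" "T \<ge> 3" "dv x = octa 0 (-1) j" "i \<noteq> j"
    and room: "ssum (\<lambda>w i. \<bar>dv w i\<bar>) (add_mset x M) i + 2 \<le> ssum sv (add_mset x M) i"
  shows "\<exists>y M'. conn T (add_mset x M) (add_mset y M') \<and> dv y = dv x \<and> image_mset dv M' = image_mset dv M \<and> 2 \<le> sv y i"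
proof (cases "2 \<le> sv x i")
  case True
  then show ?thesis by blast
next
  case False
  have x: "x \<in> Omega T" using assms(1) by simp
  have xi: "dv x i = 0" using assms(3,4) by (simp add: octa_def)
  have sxi: "sv x i = 0"
    using False even_dv_sv[of x i] dv_le_sv[of x i] xi by presburger
  \<comment> \<open>The total of \<open>dv x\<close> is -1, so \<open>T - 1\<close> is odd, and
    \<open>T \<ge> 3\<close> makes it at least 3. Only one transition of \<open>x\<close> is forced,
    which leaves a spare pair on some edge.\<close>
  have "even (tot (dv x) - int (T - 1))" by (rule Omega_parity[OF x])
  then have n: "int (T - 1) \<ge> 3"
    using \<open>T \<ge> 3\<close> unfolding assms(3) tot_octa by presburger
  have "\<exists>g. \<bar>dv x g\<bar> + 2 \<le> sv x g"
  proof (rule ccontr)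
    assume "\<not> ?thesis"
    then have "sv x g \<le> \<bar>dv x g\<bar>" for g
      using slack_ge_2[of x g] by (meson linorder_not_le)
    then have "tot (sv x) \<le> tot (\<lambda>g. \<bar>dv x g\<bar>)"
      by (simp add: tot_def add_mono)
    also have "\<dots> = 1"
      unfolding assms(3) by (cases j) (auto simp: tot_def octa_def)
    finally show False using n Omega_tot[OF x] by simp
  qed
  then obtain g where g: "\<bar>dv x g\<bar> + 2 \<le> sv x g" ..
  have gi: "g \<noteq> i" using g sxi by auto
  let ?s = "(sv x)(g := sv x g - 2, i := sv x i + 2)"
  obtain y where y: "y \<in> Omega T" "dv y = dv x" "sv y = ?s"
  proof (rule word_exists[of "dv x" ?s T])
    show "spread (dv x)" using Omega_spread x assms(2) by auto
    show "\<bar>dv x k\<bar> \<le> ?s k" for k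
      using g dv_le_sv[of x k] by auto
    show "even (?s k - dv x k)" for k
      using even_dv_sv[of x k] by auto
    show "tot ?s = int (T - 1)"
      using Omega_tot[OF x] gi by (cases g; cases i) (auto simp: tot_def)
  qed (use assms in auto)
  have M: "ssum (\<lambda>w i. \<bar>dv w i\<bar>) M k \<le> ssum sv M k" for k
    unfolding ssum_def by (intro sum_mset_mono dv_le_sv)
  have "sv y k + ssum (\<lambda>w i. \<bar>dv w i\<bar>) M k \<le> sv x k + ssum sv M k" for k
    using M[of k] room xi sxi by (auto simp: y(3))
  then obtain M' where "conn T (add_mset x M) (add_mset y M')" "image_mset dv M' = image_mset dv M"
    using conn_realign[OF assms(1) y(1) _ y(2)] assms(2) by auto
  moreover have "2 \<le> sv y i" by (simp add: y(3) sxi)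
  ultimately show ?thesis using y(2) by blast
qed

text \<open>A diagonal in a direction \<open>j\<close> that is too frequent in \<open>X\<close> is
  replaced by one in a direction \<open>i\<close> that is too rare. This decreases the distance
  between the counts of the lower vertices.\<close>

lemma conn_octa:
  assumes "set_mset X \<subseteq> Omega T" "set_mset Y \<subseteq> Omega T" "same_stat X Y" "T \<ge> 3"
    and "\<And>x. x \<in># image_mset dv X + image_mset dv Y \<Longrightarrow> \<exists>i. x = octa \<mu> 1 i \<or> x = octa \<mu> (-1) i"
  shows "\<exists>X'. conn T X X' \<and> image_mset dv X' = image_mset dv Y"
  using assms(1,3,5)
proof (induction "nat (tot (\<lambda>i. \<bar>int (count (image_mset dv X) (octa \<mu> (-1) i)) - int (count (image_mset dv Y) (octa \<mu> (-1) i))\<bar>))"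
    arbitrary: X rule: less_induct)
  case less
  let ?P = "image_mset dv X" and ?Q = "image_mset dv Y"
  let ?m = "\<lambda>P i. int (count P (octa \<mu> (-1) i))" and ?p = "\<lambda>P i. int (count P (octa \<mu> 1 i))"
  show ?case
  proof (cases "?P = ?Q")
    case True
    then show ?thesis by blast
  next
    case False
    have oP: "\<forall>x\<in>#?P. \<exists>i. x = octa \<mu> 1 i \<or> x = octa \<mu> (-1) i"
      using less.prems(3) by auto
    have oQ: "\<forall>x\<in>#?Q. \<exists>i. x = octa \<mu> 1 i \<or> x = octa \<mu> (-1) i"
      using less.prems(3) by auto
    have size: "size ?P = size ?Q" and sums: "(\<Sum>x\<in>#?P. x i) = (\<Sum>x\<in>#?Q. x i)" for i
      using less.prems(2) by (auto simp: same_stat_def ssum_def image_mset.compositionality comp_def)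
    have diff: "?p ?P i - ?p ?Q i = ?m ?P i - ?m ?Q i" for i
      using octa_counts(2)[OF oP, where i = i] octa_counts(2)[OF oQ, where i = i] sums[of i] size by simp
    have tot0: "tot (\<lambda>i. ?m ?P i - ?m ?Q i) = 0"
      using octa_counts(1)[OF oP] octa_counts(1)[OF oQ] size diff[of I1] diff[of I2] diff[of I3]
      by (simp add: tot_def)
    have "\<exists>i. ?m ?P i \<noteq> ?m ?Q i"
    proof (rule ccontr)
      assume eq: "\<not> ?thesis"
      have "count ?P x = count ?Q x" for x
      proof (cases "\<exists>i. x = octa \<mu> 1 i \<or> x = octa \<mu> (-1) i")
        case True
        then show ?thesis using eq diff by (metis eq_iff_diff_eq_0 of_nat_eq_iff)
      next
        case False
        then have "x \<notin># ?P" "x \<notin># ?Q" using oP oQ by blast+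
        then show ?thesis by (simp only: not_in_iff)
      qed
      then show False using False by (meson multiset_eqI)
    qed
    then have "\<exists>i. ?m ?P i < ?m ?Q i" "\<exists>j. ?m ?Q j < ?m ?P j"
      using tot0 unfolding ex_idx tot_def by linarith+
    then obtain i j where i: "?m ?P i < ?m ?Q i" and j: "?m ?Q j < ?m ?P j" by blast
    have ij: "i \<noteq> j" using i j by auto
    have "count ?P (octa \<mu> (-1) j) > 0" using j by linarith
    then obtain x where x: "x \<in># X" "dv x = octa \<mu> (-1) j" by (auto simp: count_greater_zero_iff)
    then obtain M where X: "X = add_mset x M" by (metis insert_DiffM)
    \<comment> \<open>The new diagonal needs
      \<open>\<bar>\<mu> - 1\<bar> + \<bar>\<mu> + 1\<bar>\<close> transitions on edge
      \<open>i\<close>, and its second word will contribute at least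
      \<open>\<bar>\<mu>\<bar>\<close>. The need exceeds \<open>2 * \<bar>\<mu>\<bar>\<close> only
      for \<mu> = 0.\<close>
    have "\<exists>x' M'. conn T X (add_mset x' M') \<and> dv x' = dv x \<and> image_mset dv M' = image_mset dv M \<and>
        \<bar>\<mu> - 1\<bar> + \<bar>\<mu> + 1\<bar> \<le> sv x' i + \<bar>\<mu>\<bar>"
    proof (cases "\<mu> = 0")
      case True
      have abs: "ssum (\<lambda>w i. \<bar>dv w i\<bar>) Z i = (\<Sum>x\<in>#image_mset dv Z. \<bar>x i\<bar>)" for Z
        by (simp add: ssum_def image_mset.compositionality comp_def)
      \<comment> \<open>\<open>Y\<close> has at least one more of each of the two vertices in
        direction \<open>i\<close>, and its forced transitions fit into the same supply.\<close>
      have "ssum (\<lambda>w i. \<bar>dv w i\<bar>) X i + 2 \<le> ssum (\<lambda>w i. \<bar>dv w i\<bar>) Y i"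
        unfolding abs octa_counts(3)[OF oP True] octa_counts(3)[OF oQ True]
        using i diff[of i] by linarith
      also have "\<dots> \<le> ssum sv Y i"
        unfolding ssum_def by (intro sum_mset_mono dv_le_sv)
      also have "\<dots> = ssum sv X i"
        using less.prems(2) by (simp add: same_stat_def)
      finally obtain x' M' where "conn T X (add_mset x' M')" "dv x' = dv x" "image_mset dv M' = image_mset dv M" "2 \<le> sv x' i"
        using conn_make_room[of x M T j i] less.prems(1) assms(4) x(2) ij unfolding X True by auto
      then show ?thesis using True by (intro exI[of _ x'] exI[of _ M']) auto
    next
      case False
      have "\<bar>\<mu>\<bar> \<le> sv x i"
        using dv_le_sv[of x i] x(2) ij by (simp add: octa_def)
      moreover have "\<bar>\<mu> - 1\<bar> + \<bar>\<mu> + 1\<bar> = 2 * \<bar>\<mu>\<bar>" using False by linarith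
      ultimately show ?thesis
        unfolding X by (intro exI[of _ x] exI[of _ M]) auto
    qed
    then obtain x' M' where x': "conn T X (add_mset x' M')" "dv x' = octa \<mu> (-1) j" "image_mset dv M' = image_mset dv M"
      "\<bar>\<mu> - 1\<bar> + \<bar>\<mu> + 1\<bar> \<le> sv x' i + \<bar>\<mu>\<bar>"
      using x(2) by metis
    have "count ?P (octa \<mu> 1 j) > 0" using j diff[of j] by linarith
    then have "octa \<mu> 1 j \<in># image_mset dv M'"
      unfolding x'(3) X using x(2) by (auto simp: octa_eq_iff count_greater_zero_iff split: if_splits)
    then obtain y where y: "y \<in># M'" "dv y = octa \<mu> 1 j" by auto
    then obtain N where M': "M' = add_mset y N" by (metis insert_DiffM)
    have inv: "set_mset (add_mset x' M') \<subseteq> Omega T" "same_stat X (add_mset x' M')"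
      using conn_invariant[OF x'(1) less.prems(1)] by auto
    then have \<Omega>: "x' \<in> Omega T" "y \<in> Omega T" using y(1) by auto
    obtain p q where pq: "p \<in> Omega T" "q \<in> Omega T" "dv p = octa \<mu> (-1) i" "dv q = octa \<mu> 1 i"
      "\<And>k. sv p k + sv q k = sv x' k + sv y k"
    proof (rule pair_replace[OF \<Omega> _ spread_octa(2)[of \<mu> i] spread_octa(1)[of \<mu> i]])
      show "octa \<mu> (-1) i k + octa \<mu> 1 i k = dv x' k + dv y k" for k
        unfolding x'(2) y(2) octa_def by auto
      show "\<bar>octa \<mu> (-1) i k\<bar> + \<bar>octa \<mu> 1 i k\<bar> \<le> sv x' k + sv y k" for k
      proof (cases "k = i")
        case True
        have "\<bar>\<mu>\<bar> \<le> sv y i" using dv_le_sv[of y i] y(2) ij by (simp add: octa_def)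
        then show ?thesis using x'(4) True by (simp add: octa_def)
      next
        case False
        have "\<bar>dv x' k\<bar> + \<bar>dv y k\<bar> \<le> sv x' k + sv y k" by (intro add_mono dv_le_sv)
        moreover have "2 * \<bar>\<mu>\<bar> \<le> \<bar>dv x' k\<bar> + \<bar>dv y k\<bar>"
          unfolding x'(2) y(2) octa_def by (simp; linarith)
        ultimately show ?thesis using False by (simp add: octa_def)
      qed
      show "\<bar>tot (octa \<mu> (-1) i)\<bar> \<le> int (T - 1)" "even (tot (octa \<mu> (-1) i) - int (T - 1))"
        using Omega_abs[OF \<Omega>(1)] Omega_parity[OF \<Omega>(1)] unfolding x'(2) tot_octa by auto
      show "\<bar>tot (octa \<mu> 1 i)\<bar> \<le> int (T - 1)"
        using Omega_abs[OF \<Omega>(2)] unfolding y(2) tot_octa .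
    qed (use assms(4) in auto)
    let ?X = "add_mset p (add_mset q N)"
    have "conn T (add_mset x' M') ?X"
      unfolding M' using \<Omega> pq ij by (intro conn_pair) (auto simp: x'(2) y(2) octa_def)
    then have conn: "conn T X ?X"
      using x'(1) by simp
    have inv': "set_mset ?X \<subseteq> Omega T" "same_stat X ?X"
      using conn_invariant[OF conn less.prems(1)] by auto
    have imgX: "?P = add_mset (octa \<mu> (-1) j) (add_mset (octa \<mu> 1 j) (image_mset dv N))"
      unfolding X using x(2) x'(3) y(2) by (simp add: M')
    have imgX': "image_mset dv ?X = add_mset (octa \<mu> (-1) i) (add_mset (octa \<mu> 1 i) (image_mset dv N))"
      using pq by simp
    have m': "?m (image_mset dv ?X) k = ?m ?P k + of_bool (k = i) - of_bool (k = j)" for k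
      unfolding imgX imgX' by (auto simp: octa_eq_iff)
    have "nat (tot (\<lambda>k. \<bar>?m (image_mset dv ?X) k - ?m ?Q k\<bar>)) < nat (tot (\<lambda>k. \<bar>?m ?P k - ?m ?Q k\<bar>))"
    proof -
      have le: "\<bar>?m (image_mset dv ?X) k - ?m ?Q k\<bar> \<le> \<bar>?m ?P k - ?m ?Q k\<bar>" for k
        unfolding m' using i j ij by auto
      have "\<bar>?m (image_mset dv ?X) i - ?m ?Q i\<bar> < \<bar>?m ?P i - ?m ?Q i\<bar>"
        unfolding m' using i j ij by auto
      then have "tot (\<lambda>k. \<bar>?m (image_mset dv ?X) k - ?m ?Q k\<bar>) < tot (\<lambda>k. \<bar>?m ?P k - ?m ?Q k\<bar>)"
        unfolding tot_nx[of _ i] by (meson le add_less_le_mono)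
      moreover have "0 \<le> tot (\<lambda>k. \<bar>?m (image_mset dv ?X) k - ?m ?Q k\<bar>)"
        by (simp add: tot_def)
      ultimately show ?thesis by linarith
    qed
    moreover have "same_stat ?X Y"
      using inv'(2) less.prems(2) unfolding same_stat_def by metis
    moreover have "\<exists>i. z = octa \<mu> 1 i \<or> z = octa \<mu> (-1) i" if "z \<in># image_mset dv ?X + ?Q" for z
      using that oQ oP unfolding imgX imgX' by auto
    ultimately obtain X' where "conn T ?X X'" "image_mset dv X' = ?Q"
      using less.hyps[of ?X] inv'(1) by blast
    then show ?thesis using conn by (meson rtranclp_trans)
  qed
qed

text \<open>Both multisets are first made stable. The comparison \<open>main\<close> needs the
  stable side to have the larger sum of squares.\<close>

lemma conn_same_stat:
  assumes "set_mset X \<subseteq> Omega T" "set_mset Y \<subseteq> Omega T" "same_stat X Y" "T \<ge> 3"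
  shows "conn T X Y"
proof -
  have T: "T \<ge> 2" "T > 0" using assms(4) by auto
  have main: "conn T X Y"
    if \<Omega>: "set_mset X \<subseteq> Omega T" "set_mset Y \<subseteq> Omega T" and same: "same_stat X Y"
      and st: "stable (image_mset dv X)"
      and le: "(\<Sum>x\<in>#image_mset dv Y. (tot x)\<^sup>2) \<le> (\<Sum>x\<in>#image_mset dv X. (tot x)\<^sup>2)" for X Y
  proof -
    let ?P = "image_mset dv X" and ?Q = "image_mset dv Y"
    have size: "size ?P = size ?Q" and sums: "\<And>i. (\<Sum>x\<in>#?P. x i) = (\<Sum>x\<in>#?Q. x i)"
      using same by (auto simp: same_stat_def ssum_def image_mset.compositionality comp_def)
    have "spread x" "even (tot x - int (T - 1))" if "x \<in># ?P + ?Q" for x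
      using that \<Omega> Omega_spread[OF _ T(2)] Omega_parity by auto
    then consider "?P = ?Q" | \<mu> where "\<forall>x\<in>#?P + ?Q. \<exists>i. x = octa \<mu> 1 i \<or> x = octa \<mu> (-1) i"
      using stable_unique[OF size sums le _ _ st] by blast
    then show ?thesis
    proof cases
      case 1
      then show ?thesis
        using \<Omega> same T by (intro conn_same_dv) (auto simp: same_stat_def)
    next
      case 2
      then obtain X' where X': "conn T X X'" "image_mset dv X' = ?Q"
        using conn_octa[OF \<Omega> same assms(4)] by blast
      have "set_mset X' \<subseteq> Omega T" "same_stat X X'"
        using conn_invariant[OF X'(1) \<Omega>(1)] by auto
      then have "conn T X' Y"
        using \<Omega>(2) X'(2) same T by (intro conn_same_dv) (auto simp: same_stat_def)
      then show ?thesis using X'(1) by simp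
    qed
  qed
  obtain X' where X': "conn T X X'" "stable (image_mset dv X')"
    using conn_stable assms(1) T(1) by blast
  obtain Y' where Y': "conn T Y Y'" "stable (image_mset dv Y')"
    using conn_stable assms(2) T(1) by blast
  have \<Omega>: "set_mset X' \<subseteq> Omega T" "set_mset Y' \<subseteq> Omega T" "same_stat X' Y'" "same_stat Y' X'"
    using conn_invariant[OF X'(1) assms(1)] conn_invariant[OF Y'(1) assms(2)] assms(3)
    by (auto simp: same_stat_def)
  \<comment> \<open>As \<open>X'\<close> and \<open>Y'\<close> are both stable, \<open>main\<close>
    can start from whichever has the larger sum of squared totals.\<close>
  have "conn T X' Y'"
    using main[OF \<Omega>(1,2,3) X'(2)] conn_sym[OF main[OF \<Omega>(2,1,4) Y'(2)]] by linarith
  then show ?thesis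
    using X'(1) conn_sym[OF Y'(1)] by (meson rtranclp_trans)
qed

section \<open>The Markov basis\<close>

lemma sum_count:
  fixes g :: "'a \<Rightarrow> int"
  assumes "finite A" "set_mset M \<subseteq> A"
  shows "(\<Sum>w\<in>A. int (count M w) * g w) = (\<Sum>w\<in>#M. g w)"
  using assms(2)
proof (induction M)
  case (add x M)
  have "(\<Sum>w\<in>A. int (count (add_mset x M) w) * g w) = (\<Sum>w\<in>A. int (count M w) * g w + (if w = x then g w else 0))"
    by (intro sum.cong) (auto simp: algebra_simps)
  also have "\<dots> = (\<Sum>w\<in>A. int (count M w) * g w) + g x"
    using add.prems assms(1) by (simp add: sum.distrib)
  finally show ?case using add by simp
qed simp

lemma edge_pairs_cases:
  assumes "(i, j) \<in> edge_pairs"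
  obtains k where "(i, j) = (src k, tgt k)" | k where "(i, j) = (tgt k, src k)"
proof -
  have "(i, j) \<in> {(src I1, tgt I1), (src I2, tgt I2), (src I3, tgt I3), (tgt I1, src I1), (tgt I2, src I2), (tgt I3, src I3)}"
    using assms by (auto simp: edge_pairs_def)
  then show thesis using that by blast
qed

lemma edge_pairs_src_tgt: "(src k, tgt k) \<in> edge_pairs" "(tgt k, src k) \<in> edge_pairs"
  by (cases k; simp add: edge_pairs_def)+

lemma suff_stat_count:
  assumes "set_mset M \<subseteq> Omega T"
  shows "suff_stat T (\<lambda>w. int (count M w)) i j = (\<Sum>w\<in>#M. int (trans_count w i j))"
  unfolding suff_stat_def using sum_count[OF finite_Omega assms] .

lemma sum_up_down:
  "2 * (\<Sum>w\<in>#M. int (trans_count w (src k) (tgt k))) = ssum sv M k + ssum dv M k"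
  "2 * (\<Sum>w\<in>#M. int (trans_count w (tgt k) (src k))) = ssum sv M k - ssum dv M k"
  by (induction M) (auto simp: sv_def dv_def up_def down_def)

text \<open>All words have \<open>T - 1\<close> transitions, so the statistic determines the number
  of words; this is the homogeneity of the ideal.\<close>

lemma size_Omega_mset:
  assumes "set_mset M \<subseteq> Omega T"
  shows "tot (ssum sv M) = int (size M) * int (T - 1)"
  using assms
proof (induction M)
  case (add w M)
  have eq: "tot (ssum sv (add_mset w M)) = tot (sv w) + tot (ssum sv M)"
    by (simp add: tot_def)
  show ?case
    unfolding eq using add Omega_tot[of w T] by (simp add: algebra_simps)
qed (simp add: tot_def)

lemma same_stat_iff:
  assumes "set_mset X \<subseteq> Omega T" "set_mset Y \<subseteq> Omega T" "T \<ge> 2"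
  shows "same_stat X Y \<longleftrightarrow> (\<forall>(i, j)\<in>edge_pairs.
    suff_stat T (\<lambda>w. int (count X w)) i j = suff_stat T (\<lambda>w. int (count Y w)) i j)"
    (is "_ \<longleftrightarrow> ?R")
proof
  assume same: "same_stat X Y"
  have "suff_stat T (\<lambda>w. int (count X w)) i j = suff_stat T (\<lambda>w. int (count Y w)) i j"
    if "(i, j) \<in> edge_pairs" for i j
    using that
  proof (cases rule: edge_pairs_cases)
    case (1 k)
    then show ?thesis
      using same sum_up_down(1)[where M = X and k = k] sum_up_down(1)[where M = Y and k = k]
      by (simp add: suff_stat_count assms same_stat_def)
  next
    case (2 k)
    then show ?thesis
      using same sum_up_down(2)[where M = X and k = k] sum_up_down(2)[where M = Y and k = k]
      by (simp add: suff_stat_count assms same_stat_def)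
  qed
  then show ?R by blast
next
  assume R: ?R
  have eq: "ssum sv X k = ssum sv Y k \<and> ssum dv X k = ssum dv Y k" for k
  proof -
    have "(\<Sum>w\<in>#X. int (trans_count w (src k) (tgt k))) = (\<Sum>w\<in>#Y. int (trans_count w (src k) (tgt k)))"
      "(\<Sum>w\<in>#X. int (trans_count w (tgt k) (src k))) = (\<Sum>w\<in>#Y. int (trans_count w (tgt k) (src k)))"
      using R edge_pairs_src_tgt[of k] by (auto simp: suff_stat_count assms)
    then show ?thesis
      using sum_up_down[where M = X and k = k] sum_up_down[where M = Y and k = k] by simp
  qed
  then have "tot (ssum sv X) = tot (ssum sv Y)" by (simp add: tot_def)
  then have "size X = size Y"
    using size_Omega_mset[OF assms(1)] size_Omega_mset[OF assms(2)] assms(3) by simp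
  then show "same_stat X Y" using eq by (simp add: same_stat_def)
qed

text \<open>\<open>K\<close> and \<open>L\<close> may share words, which cancel in the
  difference.\<close>

definition moves :: "nat \<Rightarrow> (nat list \<Rightarrow> int) set" where
  "moves T = {\<lambda>w. int (count L w) - int (count K w) | K L.
     set_mset K \<subseteq> Omega T \<and> set_mset L \<subseteq> Omega T \<and> size K \<le> 2 \<and> same_stat K L}"

lemma finite_moves: "finite (moves T)"
proof -
  let ?S = "mset ` {xs. set xs \<subseteq> Omega T \<and> length xs \<le> 2}"
  have mem: "M \<in> ?S" if "set_mset M \<subseteq> Omega T" "size M \<le> 2" for M
  proof -
    obtain xs where "mset xs = M" using ex_mset by blast
    then show ?thesis using that by auto
  qed
  have "moves T \<subseteq> (\<lambda>(K, L) w. int (count L w) - int (count K w)) ` (?S \<times> ?S)"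
  proof
    fix z assume "z \<in> moves T"
    then obtain K L where KL: "z = (\<lambda>w. int (count L w) - int (count K w))" "set_mset K \<subseteq> Omega T"
      "set_mset L \<subseteq> Omega T" "size K \<le> 2" "same_stat K L"
      unfolding moves_def by blast
    then have "(K, L) \<in> ?S \<times> ?S" using mem by (simp add: same_stat_def)
    then show "z \<in> (\<lambda>(K, L) w. int (count L w) - int (count K w)) ` (?S \<times> ?S)"
      unfolding KL(1) by (rule rev_image_eqI) simp
  qed
  moreover have "finite ?S" using finite_lists_length_le[OF finite_Omega] by simp
  ultimately show ?thesis by (meson finite_SigmaI finite_imageI finite_subset)
qed

lemma is_move_moves:
  assumes "z \<in> moves T" "T \<ge> 2"
  shows "is_move T z"
proof -
  obtain K L where z: "z = (\<lambda>w. int (count L w) - int (count K w))" and KL: "set_mset K \<subseteq> Omega T"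
    "set_mset L \<subseteq> Omega T" "same_stat K L"
    using assms(1) unfolding moves_def by blast
  have "supported T z"
    using KL(1,2) unfolding supported_def z
    by (metis count_eq_zero_iff diff_self subsetD)
  moreover have "suff_stat T z i j = suff_stat T (\<lambda>w. int (count L w)) i j - suff_stat T (\<lambda>w. int (count K w)) i j" for i j
    unfolding suff_stat_def z by (simp add: left_diff_distrib sum_subtractf)
  ultimately show ?thesis
    using KL(3) same_stat_iff[OF KL(1,2) assms(2)] unfolding is_move_def by auto
qed

lemma move_degree_moves:
  assumes "z \<in> moves T"
  shows "move_degree T z \<le> 2"
proof -
  obtain K L where z: "z = (\<lambda>w. int (count L w) - int (count K w))" and KL:
    "set_mset L \<subseteq> Omega T" "same_stat K L" "size K \<le> 2"
    using assms(1) unfolding moves_def by blast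
  \<comment> \<open>The positive part of \<open>z\<close> is at most \<open>count L\<close>, and
    \<open>L\<close> has the size of \<open>K\<close>.\<close>
  have "int (\<Sum>w\<in>Omega T. nat (z w)) \<le> (\<Sum>w\<in>Omega T. int (count L w) * 1)"
    unfolding z of_nat_sum by (intro sum_mono) auto
  also have "\<dots> = int (size L)"
    unfolding sum_count[OF finite_Omega KL(1)] by (induction L) auto
  finally have "move_degree T z \<le> size L"
    unfolding move_degree_def by (simp only: of_nat_le_iff)
  then show ?thesis
    using KL(2,3) by (simp add: same_stat_def)
qed

lemma conn_markov_steps: "conn T X Y \<Longrightarrow> (markov_step T (moves T))\<^sup>*\<^sup>* (count X) (count Y)"
proof (induction rule: rtranclp_induct)
  case (step Y Z)
  obtain K L M where KL: "Y = K + M" "Z = L + M" "size K \<le> 2" "set_mset K \<subseteq> Omega T"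
    "set_mset L \<subseteq> Omega T" "same_stat K L"
    using step.hyps(2) unfolding step_def by blast
  have "(\<lambda>w. int (count L w) - int (count K w)) \<in> moves T"
    unfolding moves_def using KL by blast
  moreover have "\<forall>w. int (count Z w) = int (count Y w) + (int (count L w) - int (count K w))"
    unfolding KL by simp
  ultimately have "markov_step T (moves T) (count Y) (count Z)"
    unfolding markov_step_def by (intro bexI[of _ "\<lambda>w. int (count L w) - int (count K w)"] disjI1)
  then show ?case using step.IH by simp
qed simp

lemma supported_count:
  fixes x :: "nat list \<Rightarrow> nat"
  assumes "supported T x"
  obtains X where "set_mset X \<subseteq> Omega T" "count X = x"
proof -
  have "{w. 0 < x w} \<subseteq> Omega T" using assms by (auto simp: supported_def)
  then have "finite {w. 0 < x w}" by (rule finite_subset) (rule finite_Omega)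
  then have c: "count (Abs_multiset x) = x" by (rule count_Abs_multiset)
  show thesis
  proof
    show "set_mset (Abs_multiset x) \<subseteq> Omega T"
      using \<open>{w. 0 < x w} \<subseteq> Omega T\<close> by (auto simp: set_mset_def c)
  qed (rule c)
qed

theorem theorem4:
  fixes T :: nat
  assumes "T \<ge> 3"
  shows "\<exists>Z. markov_basis T Z \<and> (\<forall>z\<in>Z. move_degree T z \<le> 6)"
proof (intro exI conjI ballI)
  have T: "T \<ge> 2" using assms by simp
  show "markov_basis T (moves T)"
    unfolding markov_basis_def
  proof (intro conjI ballI allI impI)
    fix x y :: "nat list \<Rightarrow> nat"
    assume "supported T x" "supported T y" and eq: "\<forall>(i, j)\<in>edge_pairs.
      suff_stat T (\<lambda>w. int (x w)) i j = suff_stat T (\<lambda>w. int (y w)) i j"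
    then obtain X Y where XY: "set_mset X \<subseteq> Omega T" "count X = x" "set_mset Y \<subseteq> Omega T" "count Y = y"
      using supported_count by metis
    then have "same_stat X Y"
      using eq same_stat_iff[OF XY(1,3) T] by simp
    then show "(markov_step T (moves T))\<^sup>*\<^sup>* x y"
      using conn_markov_steps[OF conn_same_stat[OF XY(1,3) _ assms]] XY by simp
  qed (use finite_moves is_move_moves T in auto)
  show "move_degree T z \<le> 6" if "z \<in> moves T" for z
    using move_degree_moves[OF that] by simp
qed

end
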